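(* Let $d$ be a positive integer. There do not exist $d^2$ DRACKN lines spanning $\mathbb{C}^d$. There exist $d^2$ DRACKN lines spanning $\mathbb{C}^{d^2-d}$ only if $d=3$.
   Context: A roux for a finite abelian group $\Gamma$ (identified with its image in $\mathbb{C}[\Gamma]$) is a matrix $B\in\mathbb{C}[\Gamma]^{n\times n}$ such that (R1) $B_{ii}=0$; (R2) $B_{ij}\in\Gamma$ for $i\ne j$; (R3) $B_{ji}=(B_{ij})^{-1}$ for $i\ne j$; (R4) $\{gI\}_{g\in\Gamma}$ and $\{gB\}_{g\in\Gamma}$ span an algebra. $\hat\alpha(B)$ applies the linear extension of the character $\alpha\in\hat\Gamma$ to each entry of $B$. $\lceil B\rfloor$ applies the Cayley representation of $\Gamma$ to each entry of $B$ (for $x\in\Gamma$, the $(g,h)$ entry of the image is $1$ if $xh=g$ and $0$ otherwise). The roux graph of $B$ is the graph on $[n]\times\Gamma$ with adjacency matrix $\lceil B\rfloor$; its fibres are the sets $\{i\}\times\Gamma$. Graphs are finite and simple. A graph is distance-regular if for every ordered pair $(u,v)$ of vertices the number of vertices at distance $i$ from $u$ and $j$ from $v$ depends only on $i$, $j$ and the distance between $u$ and $v$. A cover of the complete graph is a graph with a partition of its vertices into independent sets (fibres) such that the union of any two distinct fibres induces a perfect matching. A DRACKN is a connected, distance-regular cover of the complete graph in which two distinct vertices are at distance equal to the diameter if and only if they lie in the same fibre. Writing the adjacency matrix $A$ of a cover with fibres of size $r$ in $r\times r$ blocks $A_{ij}$, normalize it to $DAD^{-1}$ with $D$ block diagonal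 with first block $I$ and $j$th block $A_{1j}$ ($j>1$); let $\Pi\le S_r$ be generated by the permutations represented by the off-diagonal blocks. The cover is regular if $\Pi$ acts regularly on $[r]$ and abelian if $\Pi$ is abelian. Unit vectors have signature matrix $\mathcal S$ (self-adjoint, zero diagonal, unit-modulus off-diagonal entries) if their Gram matrix $(\langle\varphi_j,\varphi_i\rangle)_{ij}$ equals $I+\mu\mathcal S$ with $\mu>0$. DRACKN lines: a sequence of $n$ linearly dependent lines through the origin (their span has dimension less than $n$) for which there exist unit-norm representatives with signature matrix $\hat\alpha(B)$ for some $\alpha\in\hat\Gamma$ and some $n\times n$ roux $B$ for a finite abelian group $\Gamma$ whose roux graph is a regular abelian DRACKN. Roux have size $n\ge2$. *)

theory Defs
  imports
    "HOL-Analysis.Cartesian_Space"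
    "HOL-Algebra.Bij"
    "HOL-Algebra.Generated_Groups"
    "HOL-Library.Poly_Mapping"
    "HOL-Library.Disjoint_Sets"
    "Graph_Theory.Graph_Theory"
    "Jordan_Normal_Form.Schur_Decomposition"
    "Jordan_Normal_Form.VS_Connect"
begin

hide_const (open) Finite_Cartesian_Product.mat Finite_Cartesian_Product.row
  Finite_Cartesian_Product.rows Finite_Cartesian_Product.columns
  Finite_Cartesian_Product.transpose Finite_Cartesian_Product.vec
hide_type (open) Finite_Cartesian_Product.vec

section \<open>Roux\<close>

text \<open>
  A finite abelian group is a type \<open>'g\<close> of class \<open>ab_group_add\<close> and \<open>finite\<close>, written
  additively. Its complex group algebra is \<open>'g \<Rightarrow>\<^sub>0 complex\<close>, whose multiplication is
  convolution over the addition of \<open>'g\<close>; a complex scalar \<open>c\<close> is the element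
  \<open>Poly_Mapping.single 0 c\<close>. Square matrices of size \<open>n\<close> have the indices
  \<open>0, \<dots>, n - 1\<close>.
\<close>

type_synonym 'g group_alg = "'g \<Rightarrow>\<^sub>0 complex"

abbreviation group_elem :: "'g::{ab_group_add, finite} \<Rightarrow> 'g group_alg" where
  "group_elem g \<equiv> Poly_Mapping.single g 1"

inductive_set complex_span ::
  "nat \<Rightarrow> 'g::{ab_group_add, finite} group_alg mat set \<Rightarrow> 'g group_alg mat set"
  for n :: nat and S :: "'g group_alg mat set" where
  zero: "0\<^sub>m n n \<in> complex_span n S"
| base: "X \<in> S \<Longrightarrow> X \<in> complex_span n S"
| add: "X \<in> complex_span n S \<Longrightarrow> Y \<in> complex_span n S \<Longrightarrow> X + Y \<in> complex_span n S"
| smult: "X \<in> complex_span n S \<Longrightarrow> Poly_Mapping.single 0 c \<cdot>\<^sub>m X \<in> complex_span n S"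

definition roux :: "nat \<Rightarrow> 'g::{ab_group_add, finite} group_alg mat \<Rightarrow> bool" where
  "roux n B \<longleftrightarrow>
     n \<ge> 2 \<and> B \<in> carrier_mat n n \<and>
     (\<forall>i<n. B $$ (i, i) = 0) \<and>
     (\<forall>i<n. \<forall>j<n. i \<noteq> j \<longrightarrow> (\<exists>g. B $$ (i, j) = group_elem g)) \<and>
     (\<forall>i<n. \<forall>j<n. \<forall>g. i \<noteq> j \<longrightarrow> B $$ (i, j) = group_elem g \<longrightarrow>
        B $$ (j, i) = group_elem (- g)) \<and>
     (let A = complex_span n
                ((\<lambda>g. group_elem g \<cdot>\<^sub>m 1\<^sub>m n) ` UNIV \<union> (\<lambda>g. group_elem g \<cdot>\<^sub>m B) ` UNIV)
      in \<forall>X\<in>A. \<forall>Y\<in>A. X * Y \<in> A)"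

definition character :: "('g::{ab_group_add, finite} \<Rightarrow> complex) \<Rightarrow> bool" where
  "character \<alpha> \<longleftrightarrow> (\<forall>g. cmod (\<alpha> g) = 1) \<and> (\<forall>g h. \<alpha> (g + h) = \<alpha> g * \<alpha> h)"

definition char_lin :: "('g::{ab_group_add, finite} \<Rightarrow> complex) \<Rightarrow> 'g group_alg \<Rightarrow> complex" where
  "char_lin \<alpha> x = (\<Sum>g\<in>UNIV. Poly_Mapping.lookup x g * \<alpha> g)"

abbreviation char_mat ::
  "('g::{ab_group_add, finite} \<Rightarrow> complex) \<Rightarrow> 'g group_alg mat \<Rightarrow> complex mat" where
  "char_mat \<alpha> B \<equiv> map_mat (char_lin \<alpha>) B"

definition cayley :: "'g::{ab_group_add, finite} group_alg \<Rightarrow> 'g \<Rightarrow> 'g \<Rightarrow> complex" where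
  "cayley x g h = (\<Sum>k\<in>UNIV. Poly_Mapping.lookup x k * (if k + h = g then 1 else 0))"

definition roux_graph ::
  "nat \<Rightarrow> 'g::{ab_group_add, finite} group_alg mat \<Rightarrow> (nat \<times> 'g) pair_pre_digraph" where
  "roux_graph n B =
     \<lparr>pverts = {..<n} \<times> UNIV,
      parcs = {((i, g), (j, h)) | i g j h. i < n \<and> j < n \<and> cayley (B $$ (i, j)) g h = 1}\<rparr>"

section \<open>Distance-regular antipodal covers of complete graphs\<close>

text \<open>
  A finite simple graph is a \<^locale>\<open>pair_graph\<close>: a finite, symmetric, loopless set of arcs.
\<close>

definition gdist :: "'v pair_pre_digraph \<Rightarrow> 'v \<Rightarrow> 'v \<Rightarrow> ereal" where
  "gdist G u v = wf_digraph.\<mu> (with_proj G) (\<lambda>_. 1) u v"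

definition diameter :: "'v pair_pre_digraph \<Rightarrow> ereal" where
  "diameter G = (SUP u\<in>pverts G. SUP v\<in>pverts G. gdist G u v)"

definition distance_regular :: "'v pair_pre_digraph \<Rightarrow> bool" where
  "distance_regular G \<longleftrightarrow>
     (\<forall>i j :: nat. \<forall>u\<in>pverts G. \<forall>v\<in>pverts G. \<forall>u'\<in>pverts G. \<forall>v'\<in>pverts G.
        gdist G u v = gdist G u' v' \<longrightarrow>
        card {w \<in> pverts G. gdist G u w = real i \<and> gdist G v w = real j} =
        card {w \<in> pverts G. gdist G u' w = real i \<and> gdist G v' w = real j})"

definition complete_graph_cover :: "'v pair_pre_digraph \<Rightarrow> 'v set set \<Rightarrow> bool" where
  "complete_graph_cover G P \<longleftrightarrow>
     pair_graph G \<and> partition_on (pverts G) P \<and>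
     (\<forall>F\<in>P. \<forall>u\<in>F. \<forall>v\<in>F. (u, v) \<notin> parcs G) \<and>
     (\<forall>F\<in>P. \<forall>F'\<in>P. F \<noteq> F' \<longrightarrow> (\<forall>u\<in>F \<union> F'. \<exists>!v. v \<in> F \<union> F' \<and> (u, v) \<in> parcs G))"

definition drackn :: "'v pair_pre_digraph \<Rightarrow> 'v set set \<Rightarrow> bool" where
  "drackn G P \<longleftrightarrow>
     complete_graph_cover G P \<and> connected (with_proj G) \<and> distance_regular G \<and>
     (\<forall>u\<in>pverts G. \<forall>v\<in>pverts G. u \<noteq> v \<longrightarrow>
        (gdist G u v = diameter G \<longleftrightarrow> (\<exists>F\<in>P. u \<in> F \<and> v \<in> F)))"

text \<open>
  For a cover on \<open>{..<n} \<times> UNIV\<close> with fibres \<open>{i} \<times> UNIV\<close>, the blocks of the adjacency matrix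
  are indexed by the finite type \<open>'r\<close>, which plays the role of \<open>[r]\<close>.
\<close>

definition fibres :: "nat \<Rightarrow> (nat \<times> 'r) set set" where
  "fibres n = (\<lambda>i. {i} \<times> UNIV) ` {..<n}"

definition adj_block :: "(nat \<times> 'r::finite) pair_pre_digraph \<Rightarrow> nat \<Rightarrow> nat \<Rightarrow> real^'r^'r" where
  "adj_block G i j = (\<chi> a b. if ((i, a), (j, b)) \<in> parcs G then 1 else 0)"

definition diag_block :: "(nat \<times> 'r::finite) pair_pre_digraph \<Rightarrow> nat \<Rightarrow> real^'r^'r" where
  "diag_block G j = (if j = 0 then Finite_Cartesian_Product.mat 1 else adj_block G 0 j)"

definition normalized_block ::
  "(nat \<times> 'r::finite) pair_pre_digraph \<Rightarrow> nat \<Rightarrow> nat \<Rightarrow> real^'r^'r" where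
  "normalized_block G i j = diag_block G i ** adj_block G i j ** matrix_inv (diag_block G j)"

definition represented_by :: "('r::finite \<Rightarrow> 'r) \<Rightarrow> real^'r^'r \<Rightarrow> bool" where
  "represented_by \<pi> M \<longleftrightarrow> M = (\<chi> a b. if a = \<pi> b then 1 else 0)"

definition cover_perms ::
  "nat \<Rightarrow> (nat \<times> 'r::finite) pair_pre_digraph \<Rightarrow> ('r \<Rightarrow> 'r) set" where
  "cover_perms n G = generate (BijGroup UNIV)
     {\<pi> \<in> Bij UNIV. \<exists>i<n. \<exists>j<n. i \<noteq> j \<and> represented_by \<pi> (normalized_block G i j)}"

definition regular_cover :: "nat \<Rightarrow> (nat \<times> 'r::finite) pair_pre_digraph \<Rightarrow> bool" where
  "regular_cover n G \<longleftrightarrow> (\<forall>a b. \<exists>!\<pi>. \<pi> \<in> cover_perms n G \<and> \<pi> a = b)"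

definition abelian_cover :: "nat \<Rightarrow> (nat \<times> 'r::finite) pair_pre_digraph \<Rightarrow> bool" where
  "abelian_cover n G \<longleftrightarrow> comm_group (BijGroup UNIV \<lparr>carrier := cover_perms n G\<rparr>)"

section \<open>Lines\<close>

abbreviation cspace :: "nat \<Rightarrow> (complex, complex vec) module" where
  "cspace m \<equiv> module_vec TYPE(complex) m"

abbreviation cspan :: "nat \<Rightarrow> complex vec set \<Rightarrow> complex vec set" where
  "cspan m S \<equiv> LinearCombinations.module.span class_ring (cspace m) S"

abbreviation cdim :: "nat \<Rightarrow> complex vec set \<Rightarrow> nat" where
  "cdim m W \<equiv> vectorspace.dim class_ring (cspace m \<lparr>carrier := W\<rparr>)"

definition line :: "nat \<Rightarrow> complex vec set \<Rightarrow> bool" where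
  "line m l \<longleftrightarrow> (\<exists>v\<in>carrier_vec m. v \<noteq> 0\<^sub>v m \<and> l = cspan m {v})"

definition lines_span :: "nat \<Rightarrow> nat \<Rightarrow> (nat \<Rightarrow> complex vec set) \<Rightarrow> complex vec set" where
  "lines_span m n L = cspan m (\<Union>i<n. L i)"

text \<open>
  \<open>v \<bullet>c w\<close> is linear in \<open>v\<close> and conjugate-linear in \<open>w\<close>.
\<close>

definition has_signature_matrix :: "nat \<Rightarrow> (nat \<Rightarrow> complex vec) \<Rightarrow> complex mat \<Rightarrow> bool" where
  "has_signature_matrix n \<phi> S \<longleftrightarrow>
     S \<in> carrier_mat n n \<and> mat_adjoint S = S \<and>
     (\<forall>i<n. S $$ (i, i) = 0) \<and>
     (\<forall>i<n. \<forall>j<n. i \<noteq> j \<longrightarrow> cmod (S $$ (i, j)) = 1) \<and>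
     (\<exists>\<mu>::real. \<mu> > 0 \<and>
        mat n n (\<lambda>(i, j). \<phi> j \<bullet>c \<phi> i) = 1\<^sub>m n + complex_of_real \<mu> \<cdot>\<^sub>m S)"

text \<open>
  \<open>drackn_lines TYPE('g) m n L\<close>: the sequence \<open>L 0, \<dots>, L (n - 1)\<close> consists of DRACKN lines in
  \<open>\<complex>\<^sup>m\<close>, witnessed by a roux for a group whose underlying type is \<open>'g\<close>. A definition cannot
  quantify over types, so the group type is a parameter, and a statement about all DRACKN
  lines is made for an arbitrary type \<open>'g\<close>.
\<close>

definition drackn_lines ::
  "'g::{ab_group_add, finite} itself \<Rightarrow> nat \<Rightarrow> nat \<Rightarrow> (nat \<Rightarrow> complex vec set) \<Rightarrow> bool" where
  "drackn_lines _ m n L \<longleftrightarrow>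
     (\<forall>i<n. line m (L i)) \<and>
     cdim m (lines_span m n L) < n \<and>
     (\<exists>(B :: 'g group_alg mat) \<alpha> \<phi>.
        roux n B \<and> character \<alpha> \<and>
        drackn (roux_graph n B) (fibres n) \<and>
        regular_cover n (roux_graph n B) \<and> abelian_cover n (roux_graph n B) \<and>
        (\<forall>i<n. \<phi> i \<in> L i \<and> \<phi> i \<bullet>c \<phi> i = 1) \<and>
        has_signature_matrix n \<phi> (char_mat \<alpha> B))"

end

theory Submission
  imports Defs
begin

text \<open>
  Put \<open>n = d\<^sup>2\<close>. In a DRACKN the number of common neighbours of two vertices in distinct fibres
  depends only on whether they are adjacent, so \<open>S = \<alpha>(B)\<close> satisfies
  \<open>S\<^sup>2 = \<delta> S + (n - 1) I\<close> with the same real \<open>\<delta>\<close> for all nontrivial characters \<open>\<alpha>\<close>. Hence the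
  Gram matrix of \<open>n\<close> such lines spanning \<open>\<complex>\<^sup>m\<close>, \<open>m < n\<close>, is a multiple of an orthogonal projection
  of rank \<open>m\<close>. For \<open>m = d\<close> this projection, and for \<open>m = d\<^sup>2 - d\<close> the complementary one, has rank
  \<open>d\<close> and the form \<open>P = x I + y S\<close> with \<open>x = 1 / d\<close>. The entrywise square of \<open>P\<close> is the Gram
  matrix of \<open>d\<^sup>2\<close> vectors in the symmetric square of the range of \<open>P\<close>, which has dimension
  \<open>d (d + 1) / 2 < d\<^sup>2\<close>, so it is singular. But it equals \<open>x\<^sup>2 I + y\<^sup>2 S\<^sub>2\<close>, where \<open>S\<^sub>2\<close> belongs to
  the character \<open>\<alpha>\<^sup>2\<close> and therefore satisfies a known quadratic equation; singularity then forces
  \<open>y < 0\<close> and \<open>(d - 1)\<^sup>2 = d + 1\<close>, that is, \<open>d = 3\<close> and \<open>m = d\<^sup>2 - d\<close>.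
\<close>

section \<open>Rank bounds for projections\<close>

text \<open>The columns of \<open>X\<close> lie in the range of the orthogonal projection
  \<open>Q\<close>, and \<open>K\<close> inverts their Gram matrix. Hence \<open>E = X K X*\<close>
  is the orthogonal projection onto their span, with trace \<open>card J\<close>. The difference
  \<open>R = Q - E\<close> is again a Hermitian idempotent, so its trace is nonnegative.\<close>

lemma hermitian_projection_bound:
  fixes Q :: "'b \<Rightarrow> 'b \<Rightarrow> complex" and X :: "'b \<Rightarrow> 'a \<Rightarrow> complex"
  assumes fin: "finite I" "finite J"
    and herm: "\<And>x y. x \<in> I \<Longrightarrow> y \<in> I \<Longrightarrow> Q y x = cnj (Q x y)"
    and idem: "\<And>x z. x \<in> I \<Longrightarrow> z \<in> I \<Longrightarrow> (\<Sum>y\<in>I. Q x y * Q y z) = Q x z"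
    and range: "\<And>x j. x \<in> I \<Longrightarrow> j \<in> J \<Longrightarrow> (\<Sum>y\<in>I. Q x y * X y j) = X x j"
    and K_herm: "\<And>i j. i \<in> J \<Longrightarrow> j \<in> J \<Longrightarrow> K j i = cnj (K i j)"
    and inverse: "\<And>i j. i \<in> J \<Longrightarrow> j \<in> J \<Longrightarrow>
      (\<Sum>k\<in>J. (\<Sum>x\<in>I. cnj (X x i) * X x k) * K k j) = of_bool (i = j)"
  shows "real (card J) \<le> Re (\<Sum>x\<in>I. Q x x)"
proof -
  define Z where "Z x j = (\<Sum>k\<in>J. X x k * K k j)" for x j
  define E where "E x y = (\<Sum>j\<in>J. Z x j * cnj (X y j))" for x y
  define R where "R x y = Q x y - E x y" for x y
  \<comment> \<open>The columns of \<open>Z = X K\<close> are dual to those of \<open>X\<close>;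
    this yields both the idempotence and the trace of \<open>E\<close>.\<close>
  have dual: "(\<Sum>x\<in>I. cnj (X x i) * Z x j) = of_bool (i = j)" if "i \<in> J" "j \<in> J" for i j
  proof -
    have "(\<Sum>x\<in>I. cnj (X x i) * Z x j) = (\<Sum>x\<in>I. \<Sum>k\<in>J. cnj (X x i) * X x k * K k j)"
      by (simp add: Z_def sum_distrib_left mult.assoc)
    also have "\<dots> = (\<Sum>k\<in>J. (\<Sum>x\<in>I. cnj (X x i) * X x k) * K k j)"
      by (subst sum.swap) (simp add: sum_distrib_right)
    finally show ?thesis using inverse[OF that] by simp
  qed
  have E_herm: "E y x = cnj (E x y)" for x y
  proof -
    have "E y x = (\<Sum>j\<in>J. \<Sum>k\<in>J. X y k * K k j * cnj (X x j))"
      by (simp add: E_def Z_def sum_distrib_right)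
    also have "\<dots> = (\<Sum>j\<in>J. \<Sum>k\<in>J. X y j * K j k * cnj (X x k))"
      by (rule sum.swap)
    also have "\<dots> = cnj (E x y)"
      unfolding E_def Z_def cnj_sum sum_distrib_right
    proof (intro sum.cong refl)
      fix j k assume "j \<in> J" "k \<in> J"
      then show "X y j * K j k * cnj (X x k) = cnj (X x k * K k j * cnj (X y j))"
        using K_herm[of k j] by simp
    qed
    finally show ?thesis .
  qed
  have QE: "(\<Sum>y\<in>I. Q x y * E y z) = E x z" if "x \<in> I" for x z
  proof -
    have QZ: "(\<Sum>y\<in>I. Q x y * Z y j) = Z x j" for j
    proof -
      have "(\<Sum>y\<in>I. Q x y * Z y j) = (\<Sum>y\<in>I. \<Sum>k\<in>J. Q x y * X y k * K k j)"
        by (simp add: Z_def sum_distrib_left mult.assoc)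
      also have "\<dots> = (\<Sum>k\<in>J. (\<Sum>y\<in>I. Q x y * X y k) * K k j)"
        by (subst sum.swap) (simp add: sum_distrib_right)
      finally show ?thesis using that by (simp add: Z_def range)
    qed
    have "(\<Sum>y\<in>I. Q x y * E y z) = (\<Sum>y\<in>I. \<Sum>j\<in>J. Q x y * Z y j * cnj (X z j))"
      by (simp add: E_def sum_distrib_left mult.assoc)
    also have "\<dots> = (\<Sum>j\<in>J. (\<Sum>y\<in>I. Q x y * Z y j) * cnj (X z j))"
      by (subst sum.swap) (simp add: sum_distrib_right)
    finally show ?thesis by (simp add: E_def QZ)
  qed
  have EQ: "(\<Sum>y\<in>I. E x y * Q y z) = E x z" if "x \<in> I" "z \<in> I" for x z
  proof -
    have "(\<Sum>y\<in>I. E x y * Q y z) = cnj (\<Sum>y\<in>I. Q z y * E y x)"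
      using that by (auto simp: mult.commute E_herm[of x] herm[of z] intro!: sum.cong)
    then show ?thesis using QE[OF that(2)] E_herm by metis
  qed
  have EE: "(\<Sum>y\<in>I. E x y * E y z) = E x z" for x z
  proof -
    have "(\<Sum>y\<in>I. E x y * E y z) =
        (\<Sum>y\<in>I. \<Sum>i\<in>J. \<Sum>j\<in>J. Z x i * (cnj (X y i) * Z y j) * cnj (X z j))"
      unfolding E_def sum_product by (intro sum.cong refl) (simp only: mult_ac)
    also have "\<dots> = (\<Sum>i\<in>J. \<Sum>j\<in>J. \<Sum>y\<in>I. Z x i * (cnj (X y i) * Z y j) * cnj (X z j))"
      by (subst sum.swap, intro sum.cong refl, rule sum.swap)
    also have "\<dots> = (\<Sum>i\<in>J. \<Sum>j\<in>J. Z x i * of_bool (i = j) * cnj (X z j))"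
      by (intro sum.cong refl)
        (simp only: dual sum_distrib_left[symmetric] sum_distrib_right[symmetric])
    also have "\<dots> = (\<Sum>i\<in>J. \<Sum>j\<in>J. if i = j then Z x i * cnj (X z j) else 0)"
      by (intro sum.cong refl) auto
    also have "\<dots> = E x z"
      using fin by (simp add: E_def sum.delta')
    finally show ?thesis .
  qed
  have trE: "(\<Sum>x\<in>I. E x x) = of_nat (card J)"
  proof -
    have "(\<Sum>x\<in>I. E x x) = (\<Sum>j\<in>J. \<Sum>x\<in>I. cnj (X x j) * Z x j)"
      unfolding E_def by (subst sum.swap) (simp add: mult.commute)
    also have "\<dots> = (\<Sum>j\<in>J. 1)" by (intro sum.cong refl) (simp add: dual)
    finally show ?thesis by simp
  qed
  have R_herm: "R y x = cnj (R x y)" if "x \<in> I" "y \<in> I" for x y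
    using herm[OF that] E_herm[of y x] by (simp add: R_def)
  have RR: "(\<Sum>y\<in>I. R x y * R y z) = R x z" if "x \<in> I" "z \<in> I" for x z
  proof -
    have "(\<Sum>y\<in>I. R x y * R y z) = (\<Sum>y\<in>I. Q x y * Q y z) - (\<Sum>y\<in>I. Q x y * E y z)
        - (\<Sum>y\<in>I. E x y * Q y z) + (\<Sum>y\<in>I. E x y * E y z)"
      by (simp add: R_def algebra_simps sum_subtractf sum.distrib)
    then show ?thesis using that by (simp add: idem QE EQ EE R_def)
  qed
  \<comment> \<open>A diagonal entry of a Hermitian idempotent is the squared norm of its
    row.\<close>
  have "Re (R x x) \<ge> 0" if "x \<in> I" for x
  proof -
    have "R x x = (\<Sum>y\<in>I. R x y * cnj (R x y))"
      using RR[OF that that] R_herm[OF that] by (metis (no_types, lifting) sum.cong)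
    then have "Re (R x x) = (\<Sum>y\<in>I. (cmod (R x y))\<^sup>2)"
      by (simp add: complex_mult_cnj cmod_power2)
    then show ?thesis by (simp add: sum_nonneg)
  qed
  then have "Re (\<Sum>x\<in>I. R x x) \<ge> 0" by (simp add: sum_nonneg)
  then show ?thesis by (simp add: R_def sum_subtractf trE)
qed

text \<open>
  Applies the preceding bound to the projection onto the symmetric square of the range of \<open>P\<close>,
  whose trace is \<open>t (t + 1) / 2\<close>.
\<close>

lemma symmetric_square_bound:
  fixes P :: "'a \<Rightarrow> 'a \<Rightarrow> complex" and t :: real
  assumes fin: "finite J"
    and herm: "\<And>i j. i \<in> J \<Longrightarrow> j \<in> J \<Longrightarrow> P j i = cnj (P i j)"
    and idem: "\<And>i j. i \<in> J \<Longrightarrow> j \<in> J \<Longrightarrow> (\<Sum>k\<in>J. P i k * P k j) = P i j"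
    and trace: "(\<Sum>i\<in>J. P i i) = of_real t"
    and K_herm: "\<And>i j. i \<in> J \<Longrightarrow> j \<in> J \<Longrightarrow> K j i = cnj (K i j)"
    and inverse: "\<And>i j. i \<in> J \<Longrightarrow> j \<in> J \<Longrightarrow>
      (\<Sum>k\<in>J. (P i k)\<^sup>2 * K k j) = of_bool (i = j)"
  shows "real (card J) \<le> t * (t + 1) / 2"
proof -
  \<comment> \<open>\<open>Q\<close> is the tensor square of \<open>P\<close> composed with the
    symmetrizer (1 + swap) / 2. Column \<open>j\<close> of \<open>X\<close> is the tensor square of
    column \<open>j\<close> of \<open>P\<close>, so the Gram matrix of \<open>X\<close> is the
    entrywise square of \<open>P\<close>.\<close>
  define Q :: "'a \<times> 'a \<Rightarrow> 'a \<times> 'a \<Rightarrow> complex" where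
    "Q = (\<lambda>(k, l) (k', l'). (P k k' * P l l' + P k l' * P l k') / 2)"
  define X where "X = (\<lambda>(k, l) j. P k j * P l j)"
  have prod: "(\<Sum>y\<in>J \<times> J. f y) = (\<Sum>y\<in>J. \<Sum>y'\<in>J. f (y, y'))"
    for f :: "'a \<times> 'a \<Rightarrow> complex"
    by (simp add: sum.cartesian_product split_def)
  have pair: "(\<Sum>y\<in>J. \<Sum>y'\<in>J. P a y * P b y' * (P y c * P y' d)) = P a c * P b d"
    if "a \<in> J" "b \<in> J" "c \<in> J" "d \<in> J" for a b c d
  proof -
    have "(\<Sum>y\<in>J. \<Sum>y'\<in>J. P a y * P b y' * (P y c * P y' d)) =
        (\<Sum>y\<in>J. P a y * P y c) * (\<Sum>y'\<in>J. P b y' * P y' d)"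
      by (simp add: sum_product mult_ac)
    then show ?thesis using that by (simp add: idem)
  qed
  have pair': "(\<Sum>y\<in>J. \<Sum>y'\<in>J. P a y' * P b y * (P y c * P y' d)) = P b c * P a d"
    if "a \<in> J" "b \<in> J" "c \<in> J" "d \<in> J" for a b c d
    using pair[of b a c d] that by (simp add: mult_ac)
  have "real (card J) \<le> Re (\<Sum>x\<in>J \<times> J. Q x x)"
  proof (rule hermitian_projection_bound[where Q = Q and X = X and K = K])
    fix x y assume "x \<in> J \<times> J" "y \<in> J \<times> J"
    then show "Q y x = cnj (Q x y)"
      by (auto simp: Q_def split: prod.splits) (metis herm mult.commute)+
  next
    fix x z assume "x \<in> J \<times> J" "z \<in> J \<times> J"
    then obtain a b c d where xz: "x = (a, b)" "z = (c, d)" "a \<in> J" "b \<in> J" "c \<in> J" "d \<in> J"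
      by auto
    have "(\<Sum>y\<in>J \<times> J. Q x y * Q y z) =
        ((\<Sum>y\<in>J. \<Sum>y'\<in>J. P a y * P b y' * (P y c * P y' d)) +
         (\<Sum>y\<in>J. \<Sum>y'\<in>J. P a y * P b y' * (P y d * P y' c)) +
         (\<Sum>y\<in>J. \<Sum>y'\<in>J. P a y' * P b y * (P y c * P y' d)) +
         (\<Sum>y\<in>J. \<Sum>y'\<in>J. P a y' * P b y * (P y d * P y' c))) / 4"
      unfolding prod sum.distrib[symmetric] sum_divide_distrib
      by (intro sum.cong refl) (simp add: xz Q_def field_simps)
    also have "\<dots> = Q x z"
      using xz(3-) by (simp only: pair pair') (simp add: Q_def xz(1,2) field_simps)
    finally show "(\<Sum>y\<in>J \<times> J. Q x y * Q y z) = Q x z" .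
  next
    fix x j assume "x \<in> J \<times> J" "j \<in> J"
    then obtain a b where x: "x = (a, b)" "a \<in> J" "b \<in> J" by auto
    have "(\<Sum>y\<in>J \<times> J. Q x y * X y j) =
        ((\<Sum>y\<in>J. \<Sum>y'\<in>J. P a y * P b y' * (P y j * P y' j)) +
         (\<Sum>y\<in>J. \<Sum>y'\<in>J. P a y' * P b y * (P y j * P y' j))) / 2"
      unfolding prod sum.distrib[symmetric] sum_divide_distrib
      by (intro sum.cong refl) (simp add: x Q_def X_def field_simps)
    also have "\<dots> = X x j"
      using \<open>j \<in> J\<close> x(2-) by (simp only: pair pair') (simp add: X_def x(1))
    finally show "(\<Sum>y\<in>J \<times> J. Q x y * X y j) = X x j" .
  next
    fix i j assume ij: "i \<in> J" "j \<in> J"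
    have "(\<Sum>x\<in>J \<times> J. cnj (X x i) * X x k) = (P i k)\<^sup>2" if "k \<in> J" for k
    proof -
      have "(\<Sum>x\<in>J \<times> J. cnj (X x i) * X x k) =
          (\<Sum>a\<in>J. \<Sum>b\<in>J. P i a * P i b * (P a k * P b k))"
        unfolding prod
        by (intro sum.cong refl) (use ij in \<open>simp add: X_def herm[of i]\<close>)
      then show ?thesis using that ij by (simp add: pair power2_eq_square)
    qed
    then show "(\<Sum>k\<in>J. (\<Sum>x\<in>J \<times> J. cnj (X x i) * X x k) * K k j) = of_bool (i = j)"
      using inverse[OF ij] by simp
  qed (fact K_herm | simp add: fin)+
  \<comment> \<open>The unswapped half contributes (tr P)^2, the swapped half tr (P P) = tr
    P.\<close>
  also have "(\<Sum>x\<in>J \<times> J. Q x x) =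
      ((\<Sum>i\<in>J. P i i) * (\<Sum>i\<in>J. P i i) + (\<Sum>i\<in>J. \<Sum>j\<in>J. P i j * P j i)) / 2"
    unfolding prod sum_product sum.distrib[symmetric] sum_divide_distrib
    by (simp add: Q_def)
  also have "(\<Sum>i\<in>J. \<Sum>j\<in>J. P i j * P j i) = (\<Sum>i\<in>J. P i i)"
    by (intro sum.cong refl) (simp add: idem)
  also have "Re (((\<Sum>i\<in>J. P i i) * (\<Sum>i\<in>J. P i i) + (\<Sum>i\<in>J. P i i)) / 2) = t * (t + 1) / 2"
    by (simp add: trace algebra_simps)
  finally show ?thesis by simp
qed

section \<open>Signature matrices with two eigenvalues\<close>

text \<open>Encodes \<open>S^2 = \<delta> S + (n - 1) I\<close> for a signature matrix
  \<open>S\<close>. Only off-diagonal entries of the square are prescribed: the diagonal ones equal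
  \<open>n - 1\<close> because the off-diagonal entries of \<open>S\<close> have modulus one.
  Entries are a function, so that entrywise squares are easy to form.\<close>

definition quadratic_signature :: "nat \<Rightarrow> real \<Rightarrow> (nat \<Rightarrow> nat \<Rightarrow> complex) \<Rightarrow> bool" where
  "quadratic_signature n \<delta> s \<longleftrightarrow>
     (\<forall>i<n. s i i = 0) \<and>
     (\<forall>i<n. \<forall>j<n. i \<noteq> j \<longrightarrow> cmod (s i j) = 1 \<and> s j i = cnj (s i j)) \<and>
     (\<forall>i<n. \<forall>j<n. i \<noteq> j \<longrightarrow> (\<Sum>k<n. s i k * s k j) = of_real \<delta> * s i j)"

text \<open>The matrix \<open>a I + b S\<close>. By the quadratic equation these matrices are closed
  under multiplication, and every Gram matrix, projection and inverse below is of this form.\<close>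

definition affine :: "real \<Rightarrow> real \<Rightarrow> (nat \<Rightarrow> nat \<Rightarrow> complex) \<Rightarrow> nat \<Rightarrow> nat \<Rightarrow> complex" where
  "affine a b s i j = of_real a * of_bool (i = j) + of_real b * s i j"

lemma quadratic_signatureD:
  assumes "quadratic_signature n \<delta> s" "i < n" "j < n"
  shows "s i i = 0" "i \<noteq> j \<Longrightarrow> cmod (s i j) = 1" "i \<noteq> j \<Longrightarrow> s j i = cnj (s i j)"
    "i \<noteq> j \<Longrightarrow> (\<Sum>k<n. s i k * s k j) = of_real \<delta> * s i j"
  using assms unfolding quadratic_signature_def by blast+

lemma quadratic_signature_cong:
  assumes "\<And>i j. i < n \<Longrightarrow> j < n \<Longrightarrow> s i j = s' i j"
  shows "quadratic_signature n \<delta> s \<longleftrightarrow> quadratic_signature n \<delta> s'"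
  unfolding quadratic_signature_def using assms by simp

section \<open>Products, traces and inverses in the span of \<open>I\<close> and
  \<open>S\<close>\<close>

lemma quadratic_signature_square:
  assumes s: "quadratic_signature n \<delta> s" and ij: "i < n" "j < n"
  shows "(\<Sum>k<n. s i k * s k j) = of_real \<delta> * s i j + of_real (real n - 1) * of_bool (i = j)"
proof (cases "i = j")
  case False
  then show ?thesis using quadratic_signatureD(4)[OF assms] by simp
next
  case True
  have "s i k * s k i = of_bool (k \<noteq> i)" if "k < n" for k
  proof (cases "k = i")
    case False
    then have "s k i = cnj (s i k)" "cmod (s i k) = 1"
      using quadratic_signatureD[OF s ij(1) that] by auto
    then show ?thesis using False by (simp add: complex_mult_cnj flip: cmod_power2)
  qed (use quadratic_signatureD(1)[OF s ij(1) ij(1)] in simp)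
  then have "(\<Sum>k<n. s i k * s k i) = (\<Sum>k<n. of_bool (k \<noteq> i))" by simp
  also have "\<dots> = (\<Sum>k\<in>{..<n} - {i}. 1)"
    by (rule sum.mono_neutral_cong_right) auto
  also have "\<dots> = of_real (real n - 1)"
    using ij by (simp add: of_nat_diff)
  finally show ?thesis using quadratic_signatureD(1)[OF assms] True by simp
qed

lemma affine_mult:
  assumes "quadratic_signature n \<delta> s" "i < n" "j < n"
  shows "(\<Sum>k<n. affine a b s i k * affine c e s k j) =
    affine (a * c + b * e * (real n - 1)) (a * e + b * c + b * e * \<delta>) s i j"
proof -
  have "(\<Sum>k<n. affine a b s i k * affine c e s k j) =
      (\<Sum>k<n. (if k = i then of_real (a * c) * of_bool (i = j) + of_real (a * e) * s i j else 0) +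
        (if k = j then of_real (b * c) * s i j else 0) + of_real (b * e) * (s i k * s k j))"
    by (intro sum.cong refl) (auto simp: affine_def algebra_simps)
  also have "\<dots> = of_real (a * c) * of_bool (i = j) + of_real (a * e) * s i j +
      of_real (b * c) * s i j + of_real (b * e) * (\<Sum>k<n. s i k * s k j)"
    using assms by (simp add: sum.distrib sum_distrib_left)
  also have "\<dots> = affine (a * c + b * e * (real n - 1)) (a * e + b * c + b * e * \<delta>) s i j"
    unfolding quadratic_signature_square[OF assms] affine_def by (simp add: algebra_simps)
  finally show ?thesis .
qed

lemma affine_herm:
  assumes "quadratic_signature n \<delta> s" "i < n" "j < n"
  shows "affine a b s j i = cnj (affine a b s i j)"
proof (cases "i = j")
  case False
  with quadratic_signatureD(3)[OF assms] show ?thesis by (simp add: affine_def)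
qed (use quadratic_signatureD(1)[OF assms] in \<open>simp add: affine_def\<close>)

lemma affine_trace:
  assumes "quadratic_signature n \<delta> s"
  shows "(\<Sum>i<n. affine a b s i i) = of_real (real n * a)"
  using quadratic_signatureD(1)[OF assms] by (simp add: affine_def)

text \<open>If \<theta> is a root of the quadratic equation of \<open>S\<close>, then
  \<open>\<delta>\<close> - \<theta> is the other one, so \<open>(a + b \<delta>) I - b S\<close> is
  the conjugate of \<open>a I + b S\<close> and their product is \<open>- q I\<close>. Thus
  \<open>- q\<close> is the product of the values of a + b \<theta> at the two roots, and
  \<open>q \<noteq> 0\<close> expresses invertibility.\<close>

lemma affine_inverse:
  fixes a b \<delta> :: real
  assumes s: "quadratic_signature n \<delta> s" "i < n" "j < n"
    and q: "q = b\<^sup>2 * (real n - 1) - a\<^sup>2 - a * b * \<delta>" "q \<noteq> 0"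
  shows "(\<Sum>k<n. affine a b s i k * affine (- (a + b * \<delta>) / q) (b / q) s k j) = of_bool (i = j)"
proof -
  have "a * - (a + b * \<delta>) + b * b * (real n - 1) = q"
    by (simp add: q(1) power2_eq_square algebra_simps)
  then have "a * (- (a + b * \<delta>) / q) + b * (b / q) * (real n - 1) = q / q"
    by (metis add_divide_distrib times_divide_eq_left times_divide_eq_right)
  also have "\<dots> = 1" using q(2) by simp
  finally have 1: "a * (- (a + b * \<delta>) / q) + b * (b / q) * (real n - 1) = 1" .
  have 2: "a * (b / q) + b * (- (a + b * \<delta>) / q) + b * (b / q) * \<delta> = 0"
    using q(2) by (simp add: field_simps)
  show ?thesis unfolding affine_mult[OF s] 1 2 by (simp add: affine_def)
qed

text \<open>The equations \<open>idem\<close> make \<open>x I + y S\<close> a projection, of trace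
  \<open>n x\<close>. Its entrywise square is \<open>x^2 I + y^2 S2\<close>, with \<open>S2\<close>
  the entrywise square of \<open>S\<close>, and \<open>q\<close> says that this is invertible, so
  the symmetric square of the range has room for \<open>n\<close> independent vectors.\<close>

lemma signature_absolute_bound:
  fixes x y \<delta> \<delta>2 :: real
  assumes s: "quadratic_signature n \<delta> s"
    and s2: "quadratic_signature n \<delta>2 (\<lambda>i j. (s i j)\<^sup>2)"
    and idem: "x\<^sup>2 + y\<^sup>2 * (real n - 1) = x" "2 * x * y + y\<^sup>2 * \<delta> = y"
    and q: "y ^ 4 * (real n - 1) - x ^ 4 - x\<^sup>2 * y\<^sup>2 * \<delta>2 \<noteq> 0"
  shows "real n \<le> real n * x * (real n * x + 1) / 2"
proof -
  let ?s2 = "\<lambda>i j. (s i j)\<^sup>2"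
  let ?q = "(y\<^sup>2)\<^sup>2 * (real n - 1) - (x\<^sup>2)\<^sup>2 - x\<^sup>2 * y\<^sup>2 * \<delta>2"
  have q: "?q \<noteq> 0" using q by simp
  have sq: "(affine x y s i j)\<^sup>2 = affine (x\<^sup>2) (y\<^sup>2) ?s2 i j" if "i < n" "j < n" for i j
    using quadratic_signatureD(1)[OF s that]
    by (cases "i = j") (simp_all add: affine_def power_mult_distrib)
  have "real (card {..<n}) \<le> real n * x * (real n * x + 1) / 2"
  proof (rule symmetric_square_bound[where P = "affine x y s"
        and K = "affine (- (x\<^sup>2 + y\<^sup>2 * \<delta>2) / ?q) (y\<^sup>2 / ?q) ?s2"])
    fix i j assume ij: "i \<in> {..<n}" "j \<in> {..<n}"
    show "affine x y s j i = cnj (affine x y s i j)"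
      by (rule affine_herm[OF s]) (use ij in simp_all)
    show "affine (- (x\<^sup>2 + y\<^sup>2 * \<delta>2) / ?q) (y\<^sup>2 / ?q) ?s2 j i =
        cnj (affine (- (x\<^sup>2 + y\<^sup>2 * \<delta>2) / ?q) (y\<^sup>2 / ?q) ?s2 i j)"
      by (rule affine_herm[OF s2]) (use ij in simp_all)
    have "x * x + y * y * (real n - 1) = x" "x * y + y * x + y * y * \<delta> = y"
      using idem by (simp_all add: power2_eq_square algebra_simps)
    then show "(\<Sum>k<n. affine x y s i k * affine x y s k j) = affine x y s i j"
      using affine_mult[OF s, of i j] ij by simp
    have "(\<Sum>k<n. (affine x y s i k)\<^sup>2 * affine (- (x\<^sup>2 + y\<^sup>2 * \<delta>2) / ?q) (y\<^sup>2 / ?q) ?s2 k j) =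
        (\<Sum>k<n. affine (x\<^sup>2) (y\<^sup>2) ?s2 i k * affine (- (x\<^sup>2 + y\<^sup>2 * \<delta>2) / ?q) (y\<^sup>2 / ?q) ?s2 k j)"
      using ij sq by (intro sum.cong refl) simp
    also have "\<dots> = of_bool (i = j)"
      by (rule affine_inverse[OF s2]) (use ij q in simp_all)
    finally show "(\<Sum>k<n. (affine x y s i k)\<^sup>2 *
        affine (- (x\<^sup>2 + y\<^sup>2 * \<delta>2) / ?q) (y\<^sup>2 / ?q) ?s2 k j) = of_bool (i = j)" .
  qed (simp_all only: finite_lessThan affine_trace[OF s])
  then show ?thesis by simp
qed

text \<open>The projection has rank \<open>n x = d\<close>, and d^2 exceeds d (d + 1) / 2, so the
  quantity whose nonvanishing \<open>signature_absolute_bound\<close> requires must be zero. The two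
  possible values of \<open>\<delta>2\<close> give two factorizations of it: one has no zero in the
  admissible range, the other leads to \<open>d = 3\<close> and \<open>y < 0\<close>.\<close>

lemma signature_d_square:
  fixes x y \<delta> \<delta>2 :: real
  assumes d: "d \<ge> 2" and n: "n = d\<^sup>2" and x: "x = 1 / real d"
    and s: "quadratic_signature n \<delta> s"
    and s2: "quadratic_signature n \<delta>2 (\<lambda>i j. (s i j)\<^sup>2)"
    and \<delta>2: "\<delta>2 = \<delta> \<or> \<delta>2 = real n - 2"
    and idem: "x\<^sup>2 + y\<^sup>2 * (real n - 1) = x" "2 * x * y + y\<^sup>2 * \<delta> = y"
  shows "d = 3 \<and> y < 0"
proof -
  define D where "D = real d"
  have D: "D \<ge> 2" "x = 1 / D" "real n = D\<^sup>2"
    using d by (simp_all add: D_def x n)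
  have x_pos: "x > 0" using D by simp
  \<comment> \<open>Cancel \<open>D - 1\<close> in the diagonal equation, using n - 1 = (D - 1) (D +
    1) and x = 1 / D.\<close>
  have y2: "y\<^sup>2 * (D + 1) = x\<^sup>2"
  proof -
    have "y\<^sup>2 * (D\<^sup>2 - 1) = x - x\<^sup>2" using idem D by simp
    also have "\<dots> = x\<^sup>2 * (D - 1)" using D by (simp add: field_simps power2_eq_square)
    finally have "(y\<^sup>2 * (D + 1)) * (D - 1) = x\<^sup>2 * (D - 1)"
      by (simp add: algebra_simps power2_eq_square)
    then show ?thesis using D by simp
  qed
  have "y \<noteq> 0" using y2 x_pos by auto
  then have "y\<^sup>2 * 1 < y\<^sup>2 * (D + 1)" using D by (intro mult_strict_left_mono) auto
  then have y2_less: "y\<^sup>2 < x\<^sup>2" using y2 by simp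
  have "\<not> real n \<le> real n * x * (real n * x + 1) / 2"
  proof -
    have "real n * x = D" using D by (simp add: power2_eq_square)
    moreover have "D * 1 < D * D" using D by (intro mult_strict_left_mono) auto
    ultimately show ?thesis using D by (simp add: algebra_simps power2_eq_square)
  qed
  then have q: "y ^ 4 * (real n - 1) - x ^ 4 - x\<^sup>2 * y\<^sup>2 * \<delta>2 = 0"
    using signature_absolute_bound[OF s s2 idem] by blast
  \<comment> \<open>For \<open>\<delta>2 = n - 2\<close> the roots of the equation of
    \<open>S2\<close> are -1 and n - 1; the two factors are, up to sign, x^2 - y^2 and x^2 + (n - 1)
    y^2, both nonzero.\<close>
  have "\<delta>2 \<noteq> real n - 2"
  proof
    assume "\<delta>2 = real n - 2"
    with q have "(y\<^sup>2 - x\<^sup>2) * (y\<^sup>2 * (real n - 1) + x\<^sup>2) = 0"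
      by (simp add: algebra_simps power2_eq_square power4_eq_xxxx)
    moreover have "y\<^sup>2 * (real n - 1) + x\<^sup>2 > 0" using idem(1) x_pos by simp
    ultimately show False using y2_less by simp
  qed
  with \<delta>2 have "\<delta>2 = \<delta>" by blast
  \<comment> \<open>Both equations \<open>idem\<close> are used to eliminate \<open>\<delta>\<close>
    and \<open>n\<close>; the factor \<open>y - x\<close> is then excluded by
    \<open>y2_less\<close>.\<close>
  have "(y - x) * (x ^ 3 + y * (y\<^sup>2 * (real n - 1))) =
      y ^ 4 * (real n - 1) - x ^ 4 - x\<^sup>2 * (y\<^sup>2 * \<delta>)"
  proof -
    have 1: "y\<^sup>2 * \<delta> = y - 2 * x * y" and 2: "y\<^sup>2 * (real n - 1) = x - x\<^sup>2"
      using idem by simp_all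
    have 3: "y ^ 4 * (real n - 1) = y\<^sup>2 * (x - x\<^sup>2)"
      unfolding 2[symmetric] by (simp add: power2_eq_square power4_eq_xxxx)
    show ?thesis unfolding 1 2 3
      by (simp add: algebra_simps power2_eq_square power3_eq_cube power4_eq_xxxx)
  qed
  also have "\<dots> = 0" using q \<open>\<delta>2 = \<delta>\<close> by (simp add: mult.assoc)
  finally have "x ^ 3 + y * (y\<^sup>2 * (real n - 1)) = 0" using y2_less by auto
  moreover have "y\<^sup>2 * (real n - 1) = x * (1 - x)"
    using idem(1) by (simp add: algebra_simps power2_eq_square)
  ultimately have "x ^ 3 + y * (x * (1 - x)) = 0" by simp
  then have "x * (x\<^sup>2 + y * (1 - x)) = 0"
    by (simp add: algebra_simps power2_eq_square power3_eq_cube)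
  then have xy: "x\<^sup>2 = - (y * (1 - x))" using x_pos by simp
  have x_less: "x < 1" using D by simp
  have "y < 0"
  proof (rule ccontr)
    assume "\<not> y < 0"
    then have "y * (1 - x) \<ge> 0" using x_less by simp
    moreover have "x\<^sup>2 > 0" using x_pos by simp
    ultimately show False using xy by linarith
  qed
  \<comment> \<open>Squaring \<open>xy\<close> and inserting \<open>y2\<close> eliminates
    \<open>y\<close> and leaves an equation in \<open>D\<close> alone.\<close>
  have "y\<^sup>2 * (1 - x)\<^sup>2 = x ^ 4"
  proof -
    have "x ^ 4 = (x\<^sup>2)\<^sup>2" by simp
    then show ?thesis unfolding xy by (simp add: power_mult_distrib)
  qed
  also have "\<dots> = x\<^sup>2 * (y\<^sup>2 * (D + 1))" using y2 by (simp add: power2_eq_square power4_eq_xxxx)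
  finally have "(1 - x)\<^sup>2 = x\<^sup>2 * (D + 1)" using \<open>y \<noteq> 0\<close> by simp
  then have "(D - 1)\<^sup>2 = D + 1" using D by (simp add: field_simps power2_eq_square)
  then have "D * (D - 3) = 0" by (simp add: algebra_simps power2_eq_square)
  then have "d = 3" using D by (simp add: D_def)
  with \<open>y < 0\<close> show ?thesis by blast
qed

text \<open>Since the \<open>n\<close> vectors lie in dimension \<open>m < n\<close>, their Gram
  matrix \<open>G = I + \<mu> S\<close> is singular and satisfies \<open>G^2 = p G\<close>. As they
  span (hypothesis \<open>span\<close>, in dual form), they form a tight frame with constant
  \<open>p\<close>. Comparing traces gives \<open>p m = n\<close>, so
  \<open>x I + y S = G / p\<close> is idempotent.\<close>

lemma gram_projection:
  fixes \<phi> :: "nat \<Rightarrow> nat \<Rightarrow> complex" and \<mu> \<delta> :: real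
  assumes s: "quadratic_signature n \<delta> s" and mn: "m < n"
    and gram: "\<And>i j. i < n \<Longrightarrow> j < n \<Longrightarrow> (\<Sum>a<m. cnj (\<phi> i a) * \<phi> j a) = affine 1 \<mu> s i j"
    and span: "\<And>w. (\<And>i. i < n \<Longrightarrow> (\<Sum>a<m. w a * \<phi> i a) = 0) \<Longrightarrow> (\<And>a. a < m \<Longrightarrow> w a = 0)"
    and x: "x = real m / real n" and y: "y = \<mu> * x"
  shows "x\<^sup>2 + y\<^sup>2 * (real n - 1) = x" "2 * x * y + y\<^sup>2 * \<delta> = y"
proof -
  define q where "q = \<mu>\<^sup>2 * (real n - 1) - 1\<^sup>2 - 1 * \<mu> * \<delta>"
  \<comment> \<open>Otherwise \<open>G\<close> is invertible, and the rank bound with the identity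
    of size \<open>m\<close> as projection gives \<open>n \<le> m\<close>.\<close>
  have "q = 0"
  proof (rule ccontr)
    have delta: "(\<Sum>b<m. of_bool (a = b) * f b) = f a" if "a \<in> {..<m}"
      for a and f :: "nat \<Rightarrow> complex"
    proof -
      have "(\<Sum>b<m. of_bool (a = b) * f b) = (\<Sum>b<m. if a = b then f b else 0)"
        by (intro sum.cong refl) simp
      then show ?thesis using that by simp
    qed
    assume "q \<noteq> 0"
    let ?K = "affine (- (1 + \<mu> * \<delta>) / q) (\<mu> / q) s"
    have "real (card {..<n}) \<le> Re (\<Sum>a<m. of_bool (a = a))"
    proof (rule hermitian_projection_bound[where X = "\<lambda>a j. \<phi> j a" and K = ?K
          and Q = "\<lambda>a b. of_bool (a = b)"])
      fix i j assume ij: "i \<in> {..<n}" "j \<in> {..<n}"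
      show "?K j i = cnj (?K i j)" by (rule affine_herm[OF s]) (use ij in simp_all)
      have "(\<Sum>k<n. (\<Sum>a<m. cnj (\<phi> i a) * \<phi> k a) * ?K k j) = (\<Sum>k<n. affine 1 \<mu> s i k * ?K k j)"
        using ij gram by simp
      also have "\<dots> = of_bool (i = j)"
        using ij by (intro affine_inverse[OF s _ _ q_def \<open>q \<noteq> 0\<close>]) simp_all
      finally show "(\<Sum>k<n. (\<Sum>a<m. cnj (\<phi> i a) * \<phi> k a) * ?K k j) = of_bool (i = j)" .
    qed (simp_all only: delta finite_lessThan, simp add: eq_commute)
    then show False using mn by simp
  qed
  \<comment> \<open>\<open>p\<close> is the diagonal entry of \<open>G^2\<close>. As 0 is a root of
    the quadratic equation of \<open>G\<close>, the other root is \<open>2 + \<mu> \<delta>\<close>,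
    which equals \<open>p\<close>.\<close>
  define p where "p = 1 + \<mu>\<^sup>2 * (real n - 1)"
  have p: "p > 0" using mn by (simp add: p_def add_pos_nonneg)
  have p': "2 * \<mu> + \<mu>\<^sup>2 * \<delta> = \<mu> * p"
  proof -
    have "\<mu> * q = 0" using \<open>q = 0\<close> by simp
    then show ?thesis by (simp add: p_def q_def algebra_simps power2_eq_square)
  qed
  \<comment> \<open>\<open>H = G - p I\<close>, so \<open>G H = 0\<close>. With \<Phi> the matrix of
    columns \<open>\<phi> j\<close>, \<open>Y\<close> is \<Phi> H; since \<Phi>* Y = G H = 0, also
    Y* Y = 0 and hence \<open>Y = 0\<close>.\<close>
  define H where "H = affine (1 - p) \<mu> s"
  define Y where "Y a j = (\<Sum>k<n. \<phi> k a * H k j)" for a j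
  have GH: "(\<Sum>l<n. affine 1 \<mu> s k l * H l j) = 0" if "k < n" "j < n" for k j
  proof -
    have 1: "1 * (1 - p) + \<mu> * \<mu> * (real n - 1) = 0" by (simp add: p_def power2_eq_square)
    have 2: "1 * \<mu> + \<mu> * (1 - p) + \<mu> * \<mu> * \<delta> = 0"
      using p' by (simp add: power2_eq_square algebra_simps)
    show ?thesis unfolding H_def affine_mult[OF s that] 1 2 by (simp add: affine_def)
  qed
  have \<phi>Y: "(\<Sum>a<m. cnj (\<phi> k a) * Y a j) = 0" if "k < n" "j < n" for k j
  proof -
    have "(\<Sum>a<m. cnj (\<phi> k a) * Y a j) = (\<Sum>a<m. \<Sum>l<n. cnj (\<phi> k a) * \<phi> l a * H l j)"
      by (simp add: Y_def sum_distrib_left mult.assoc)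
    also have "\<dots> = (\<Sum>l<n. (\<Sum>a<m. cnj (\<phi> k a) * \<phi> l a) * H l j)"
      by (subst sum.swap) (simp add: sum_distrib_right)
    also have "\<dots> = (\<Sum>l<n. affine 1 \<mu> s k l * H l j)" using gram that by simp
    finally show ?thesis using GH that by simp
  qed
  have Y0: "Y a j = 0" if "a < m" "j < n" for a j
  proof -
    have "(\<Sum>a<m. cnj (Y a j) * Y a j) = (\<Sum>a<m. \<Sum>k<n. cnj (H k j) * (cnj (\<phi> k a) * Y a j))"
      by (subst (1) Y_def) (simp add: sum_distrib_left sum_distrib_right mult_ac)
    also have "\<dots> = (\<Sum>k<n. cnj (H k j) * (\<Sum>a<m. cnj (\<phi> k a) * Y a j))"
      by (subst sum.swap) (simp add: sum_distrib_left)
    also have "\<dots> = 0" using \<phi>Y that by simp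
    also have "(\<Sum>a<m. cnj (Y a j) * Y a j) = of_real (\<Sum>a<m. (cmod (Y a j))\<^sup>2)"
      by (simp add: complex_norm_square[unfolded of_real_power] mult.commute)
    finally have "(\<Sum>a<m. (cmod (Y a j))\<^sup>2) = 0" by (simp only: of_real_eq_0_iff)
    then show ?thesis using that by (subst (asm) sum_nonneg_eq_0_iff) auto
  qed
  have frame: "(\<Sum>j<n. \<phi> j a * cnj (\<phi> j a)) = of_real p" if "a < m" for a
  proof -
    \<comment> \<open>\<open>w\<close> is row \<open>a\<close> of \<Phi> \<Phi>* - p I. Its products
      with the vectors \<open>\<phi> i\<close> are row \<open>a\<close> of \<open>Y\<close>, hence
      zero, so \<open>span\<close> forces \<open>w = 0\<close>.\<close>
    define w where "w b = (\<Sum>j<n. \<phi> j a * cnj (\<phi> j b)) - of_real p * of_bool (a = b)" for b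
    have "(\<Sum>b<m. w b * \<phi> i b) = 0" if i: "i < n" for i
    proof -
      have "(\<Sum>b<m. w b * \<phi> i b) = (\<Sum>b<m. \<Sum>j<n. \<phi> j a * (cnj (\<phi> j b) * \<phi> i b))
          - (\<Sum>b<m. of_real p * of_bool (a = b) * \<phi> i b)"
        by (simp add: w_def left_diff_distrib sum_subtractf sum_distrib_right mult.assoc)
      also have "(\<Sum>b<m. \<Sum>j<n. \<phi> j a * (cnj (\<phi> j b) * \<phi> i b)) =
          (\<Sum>j<n. \<phi> j a * (\<Sum>b<m. cnj (\<phi> j b) * \<phi> i b))"
        by (subst sum.swap) (simp add: sum_distrib_left)
      also have "\<dots> = (\<Sum>j<n. \<phi> j a * affine 1 \<mu> s j i)" using gram i by simp
      also have "(\<Sum>b<m. of_real p * of_bool (a = b) * \<phi> i b) =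
          (\<Sum>b<m. if a = b then of_real p * \<phi> i b else 0)"
        by (intro sum.cong refl) simp
      also have "\<dots> = (\<Sum>j<n. if i = j then of_real p * \<phi> j a else 0)"
        using \<open>a < m\<close> i by (simp add: sum.delta')
      also have "(\<Sum>j<n. \<phi> j a * affine 1 \<mu> s j i) - \<dots> = Y a i"
        unfolding Y_def sum_subtractf[symmetric]
        by (intro sum.cong refl) (auto simp: H_def affine_def algebra_simps)
      finally show ?thesis using Y0 \<open>a < m\<close> i by simp
    qed
    then have "w a = 0" using span that by blast
    then show ?thesis by (simp add: w_def)
  qed
  have "of_real (p * real m) = (\<Sum>a<m. \<Sum>j<n. \<phi> j a * cnj (\<phi> j a))" using frame by simp
  also have "\<dots> = (\<Sum>j<n. \<Sum>a<m. cnj (\<phi> j a) * \<phi> j a)"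
    by (subst sum.swap) (simp add: mult.commute)
  also have "\<dots> = (\<Sum>j<n. affine 1 \<mu> s j j)" using gram by simp
  also have "\<dots> = of_real (real n)" by (simp add: affine_trace[OF s])
  finally have pm: "p * real m = real n" by (simp only: of_real_eq_iff)
  have xp: "x * p = 1" using pm mn p by (simp add: x mult.commute)
  have "x\<^sup>2 + y\<^sup>2 * (real n - 1) = x * (x * p)"
    by (simp add: y p_def power2_eq_square algebra_simps)
  then show "x\<^sup>2 + y\<^sup>2 * (real n - 1) = x" by (simp add: xp)
  have "2 * x * y + y\<^sup>2 * \<delta> = x * (x * (2 * \<mu> + \<mu>\<^sup>2 * \<delta>))"
    by (simp add: y power2_eq_square algebra_simps)
  also have "\<dots> = x * p * y" by (simp only: p') (simp add: y)
  finally show "2 * x * y + y\<^sup>2 * \<delta> = y" by (simp add: xp)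
qed

section \<open>Distances in antipodal covers\<close>

context pair_graph
begin

lemma gdist_le_length:
  assumes "awalk u p v"
  shows "gdist G u v \<le> ereal (real (length p))"
proof -
  have "awalk_cost (\<lambda>_. 1) p = real (length p)" for p :: "('a \<times> 'a) list"
    by (induction p) auto
  then show ?thesis using min_cost_le_walk_cost[OF assms, of "\<lambda>_. 1"]
    by (simp add: gdist_def)
qed

lemma walk_if_gdist_less:
  assumes "gdist G u v < ereal (real (Suc k))"
  obtains p where "awalk u p v" "length p \<le> k"
proof -
  have "awalk_cost (\<lambda>_. 1) p = real (length p)" for p :: "('a \<times> 'a) list"
    by (induction p) auto
  then show ?thesis
    using assms that unfolding gdist_def \<mu>_def by (force simp: INF_less_iff)
qed

lemma gdist_less_2_iff:
  assumes "u \<noteq> v"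
  shows "gdist G u v < 2 \<longleftrightarrow> (u, v) \<in> parcs G"
proof
  assume "gdist G u v < 2"
  then have "gdist G u v < ereal (real (Suc 1))" by (simp add: numeral_eq_ereal)
  then obtain p where "awalk u p v" "length p \<le> 1" by (rule walk_if_gdist_less)
  with assms show "(u, v) \<in> parcs G"
    by (cases p) (auto simp: awalk_simps le_Suc_eq)
next
  assume a: "(u, v) \<in> parcs G"
  then have "awalk u [(u, v)] v" by (auto simp: awalk_simps dest: in_arcsD2)
  from gdist_le_length[OF this] have "gdist G u v \<le> ereal 1" by simp
  also have "\<dots> < 2" by (simp add: numeral_eq_ereal)
  finally show "gdist G u v < 2" .
qed

lemma gdist_eq_1_iff:
  assumes "u \<in> pverts G"
  shows "gdist G u v = 1 \<longleftrightarrow> (u, v) \<in> parcs G"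
proof
  assume d: "gdist G u v = 1"
  have "u \<noteq> v"
  proof
    assume "u = v"
    then have "awalk u [] v" using assms by (simp add: awalk_simps)
    from gdist_le_length[OF this] show False using d by (simp add: one_ereal_def)
  qed
  moreover have "gdist G u v < 2" using d by simp
  ultimately show "(u, v) \<in> parcs G" using gdist_less_2_iff by blast
next
  assume a: "(u, v) \<in> parcs G"
  then have "awalk u [(u, v)] v" by (auto simp: awalk_simps dest: in_arcsD2)
  from gdist_le_length[OF this] have "gdist G u v \<le> ereal 1" by simp
  moreover have "\<not> gdist G u v < ereal (real (Suc 0))"
  proof
    assume "gdist G u v < ereal (real (Suc 0))"
    then obtain p where "awalk u p v" "length p \<le> 0" by (rule walk_if_gdist_less)
    then have "u = v" by (simp add: awalk_simps)
    with a show False using pair_no_loops by fastforce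
  qed
  ultimately show "gdist G u v = 1" by (simp add: one_ereal_def order_antisym)
qed

end

text \<open>
  If \<open>x\<close> is a vertex at distance 2 from \<open>u\<close>, then the neighbour of \<open>u\<close> in the fibre of \<open>x\<close> is
  within distance 3 of \<open>x\<close>, so that the diameter is at most 3.
\<close>

lemma drackn_gdist_eq_2:
  assumes dr: "drackn G P" and F: "F \<in> P" "F' \<in> P" "F \<noteq> F'" "u \<in> F" "v \<in> F'"
    and nonadj: "(u, v) \<notin> parcs G"
  shows "gdist G u v = 2"
proof -
  from dr have cover: "complete_graph_cover G P" and conn: "connected (with_proj G)"
    and antipodal: "\<And>u v. u \<in> pverts G \<Longrightarrow> v \<in> pverts G \<Longrightarrow> u \<noteq> v \<Longrightarrow>
      gdist G u v = diameter G \<longleftrightarrow> (\<exists>F\<in>P. u \<in> F \<and> v \<in> F)"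
    unfolding drackn_def by blast+
  from cover interpret pair_graph G by (simp add: complete_graph_cover_def)
  note cover_parts = cover[unfolded complete_graph_cover_def, THEN conjunct2]
  note part = cover_parts[THEN conjunct1]
  note indep = cover_parts[THEN conjunct2, THEN conjunct1, rule_format]
  note matching = cover_parts[THEN conjunct2, THEN conjunct2, rule_format]
  have same: "F1 = F2" if "F1 \<in> P" "F2 \<in> P" "x \<in> F1" "x \<in> F2" for F1 F2 x
    using partition_onD2[OF part] that unfolding disjoint_def by blast
  have V: "u \<in> pverts G" "v \<in> pverts G"
    using F partition_onD1[OF part] by blast+
  have uv: "u \<noteq> v" using F same by blast
  have le_diam: "gdist G x y \<le> diameter G" if "x \<in> pverts G" "y \<in> pverts G" for x y
    unfolding diameter_def by (rule SUP_upper2[OF that(1) SUP_upper[OF that(2)]])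
  have "gdist G u v \<noteq> diameter G"
    using antipodal[OF V uv] F same by blast
  with le_diam[OF V] have less_diam: "gdist G u v < diameter G" by simp
  have ge2: "\<not> gdist G u v < 2" using gdist_less_2_iff[OF uv] nonadj by simp
  \<comment> \<open>Otherwise \<open>u\<close> and its neighbours are closed under adjacency, and
    connectedness makes \<open>v\<close> a neighbour of \<open>u\<close>.\<close>
  have "\<exists>y x. (u, y) \<in> parcs G \<and> (y, x) \<in> parcs G \<and> x \<noteq> u \<and> (u, x) \<notin> parcs G"
  proof (rule ccontr)
    assume contr: "\<not> ?thesis"
    have "u \<rightarrow>\<^sup>*\<^bsub>mk_symmetric (with_proj G)\<^esub> v"
      using conn V by (simp add: connected_def strongly_connected_def)
    then have "u \<rightarrow>\<^sup>*\<^bsub>with_proj G\<^esub> v"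
      using reachable_mk_symmetric_eq[OF pair_sym_arcs] by simp
    then have "v = u \<or> (u, v) \<in> parcs G"
    proof (induction rule: reachable_induct)
      case (step x y)
      then have "(x, y) \<in> parcs G" by simp
      with step.IH contr show ?case by blast
    qed simp
    then show False using uv nonadj by blast
  qed
  then obtain y x where yx: "(u, y) \<in> parcs G" "(y, x) \<in> parcs G" "x \<noteq> u" "(u, x) \<notin> parcs G"
    by blast
  have xV: "x \<in> pverts G" using yx in_arcsD2 by blast
  then obtain F2 where F2: "F2 \<in> P" "x \<in> F2" using partition_onD1[OF part] by blast
  have "diameter G \<le> ereal (real 3)"
  proof (cases "F2 = F")
    \<comment> \<open>Here \<open>x\<close> and \<open>u\<close> are antipodal themselves, joined by
      a walk of length 2.\<close>
    case True
    have "awalk u [(u, y), (y, x)] x" using yx xV by (simp add: awalk_simps)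
    from gdist_le_length[OF this] have "gdist G u x \<le> ereal (real 3)"
      by (rule order_trans) simp
    moreover have "gdist G u x = diameter G"
      using antipodal[OF V(1) xV] yx(3) F F2 True by blast
    ultimately show ?thesis by simp
  next
    case False
    obtain w where w: "w \<in> F \<union> F2" "(u, w) \<in> parcs G"
      using matching[OF F(1) F2(1) False[symmetric]] F(4) by (metis UnI1)
    have "w \<in> F2" using w indep F by blast
    have wV: "w \<in> pverts G" using w in_arcsD2 by blast
    have wu: "(w, u) \<in> parcs G" using w arcs_symmetric by blast
    have "awalk w [(w, u), (u, y), (y, x)] x" using yx xV wu by (simp add: awalk_simps)
    from gdist_le_length[OF this] have "gdist G w x \<le> ereal (real 3)" by simp
    moreover have "w \<noteq> x" using w(2) yx(4) by metis
    then have "gdist G w x = diameter G"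
      using antipodal[OF wV xV] F2 \<open>w \<in> F2\<close> by blast
    ultimately show ?thesis by simp
  qed
  \<comment> \<open>The distance is below the diameter, hence below 3; a walk of length at most 2
    then bounds it by 2.\<close>
  with less_diam have "gdist G u v < ereal (real (Suc 2))" by simp
  then obtain p where "awalk u p v" "length p \<le> 2" by (rule walk_if_gdist_less)
  have "gdist G u v \<le> ereal (real (length p))" by (rule gdist_le_length) fact
  also have "\<dots> \<le> 2" using \<open>length p \<le> 2\<close> by (simp add: numeral_eq_ereal)
  finally have "gdist G u v \<le> 2" .
  with ge2 show ?thesis by simp
qed

section \<open>The quadratic equation of a roux\<close>

lemma char_lin_group_elem [simp]: "char_lin \<alpha> (group_elem g) = \<alpha> g"
proof -
  have "char_lin \<alpha> (group_elem g) = (\<Sum>h\<in>UNIV. if g = h then \<alpha> h else 0)"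
    unfolding char_lin_def by (intro sum.cong refl) (simp add: lookup_single when_def)
  then show ?thesis by simp
qed

lemma cayley_group_elem [simp]: "cayley (group_elem b) g h = of_bool (b + h = g)"
proof -
  have "cayley (group_elem b) g h = (\<Sum>k\<in>UNIV. if b = k then of_bool (k + h = g) else 0)"
    unfolding cayley_def by (intro sum.cong refl) (simp add: lookup_single when_def)
  then show ?thesis by simp
qed

lemma character_0: "character \<alpha> \<Longrightarrow> \<alpha> 0 = 1"
  unfolding character_def by (metis add_0 mult_cancel_right2 norm_zero zero_neq_one)

lemma character_uminus:
  assumes "character \<alpha>"
  shows "\<alpha> (- g) = cnj (\<alpha> g)"
proof -
  have "\<alpha> g * \<alpha> (- g) = 1"
    using assms character_0[OF assms] unfolding character_def by (metis right_minus)
  moreover have "\<alpha> g * cnj (\<alpha> g) = 1"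
    using assms by (simp add: character_def complex_norm_square[symmetric])
  ultimately show ?thesis by (metis mult.commute mult.left_commute mult.right_neutral)
qed

text \<open>Translation by \<open>h\<close> permutes the group, so multiplying the sum by
  \<open>\<alpha> h\<close> leaves it unchanged.\<close>

lemma sum_character:
  fixes \<alpha> :: "'g::{ab_group_add, finite} \<Rightarrow> complex"
  assumes \<alpha>: "character \<alpha>" and h: "\<alpha> h \<noteq> 1"
  shows "(\<Sum>g\<in>UNIV. \<alpha> g) = 0"
proof -
  have "\<alpha> h * (\<Sum>g\<in>UNIV. \<alpha> g) = (\<Sum>g\<in>UNIV. \<alpha> (h + g))"
    using \<alpha> by (simp add: character_def sum_distrib_left)
  also have "\<dots> = (\<Sum>g\<in>UNIV. \<alpha> g)"
    by (rule sum.reindex_bij_witness[where i = "\<lambda>g. g - h" and j = "\<lambda>g. h + g"]) auto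
  finally show ?thesis using h by simp
qed

lemma distance_regular_common_neighbours:
  assumes "distance_regular G"
  obtains c where "\<And>u v. u \<in> pverts G \<Longrightarrow> v \<in> pverts G \<Longrightarrow> gdist G u v = D \<Longrightarrow>
    card {w \<in> pverts G. gdist G u w = 1 \<and> gdist G v w = 1} = c"
proof (cases "\<exists>u\<in>pverts G. \<exists>v\<in>pverts G. gdist G u v = D")
  case True
  then obtain u v where uv: "u \<in> pverts G" "v \<in> pverts G" "gdist G u v = D" by blast
  have "card {w \<in> pverts G. gdist G u' w = 1 \<and> gdist G v' w = 1} =
      card {w \<in> pverts G. gdist G u w = 1 \<and> gdist G v w = 1}"
    if "u' \<in> pverts G" "v' \<in> pverts G" "gdist G u' v' = D" for u' v'
    using assms[unfolded distance_regular_def, rule_format, OF that(1,2) uv(1,2), of 1 1] that uv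
    by (simp add: one_ereal_def)
  then show ?thesis by (rule that)
qed (use that in blast)

text \<open>The exponents \<open>b i j\<close> form a voltage assignment on the complete graph:
  products of off-diagonal entries of \<open>B\<close> become sums in the group. Values on the
  diagonal of \<open>b\<close> are unconstrained.\<close>

locale roux_voltage =
  fixes n :: nat and B :: "'g::{ab_group_add, finite} group_alg mat" and b :: "nat \<Rightarrow> nat \<Rightarrow> 'g"
  assumes diag: "\<And>i. i < n \<Longrightarrow> B $$ (i, i) = 0"
    and off_diag: "\<And>i j. i < n \<Longrightarrow> j < n \<Longrightarrow> i \<noteq> j \<Longrightarrow> B $$ (i, j) = group_elem (b i j)"
    and skew: "\<And>i j. i < n \<Longrightarrow> j < n \<Longrightarrow> i \<noteq> j \<Longrightarrow> b j i = - b i j"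
begin

lemma arc_iff:
  "((i, g), (j, h)) \<in> parcs (roux_graph n B) \<longleftrightarrow> i < n \<and> j < n \<and> i \<noteq> j \<and> b i j + h = g"
  by (cases "i = j") (auto simp: roux_graph_def diag off_diag, simp add: cayley_def)

text \<open>The set counted corresponds to the common neighbours of \<open>(i, g)\<close> and
  \<open>(j, 0)\<close>. These vertices are adjacent exactly when \<open>g = b i j\<close> and are
  otherwise at distance 2, so distance-regularity supplies one number for each case.\<close>

lemma common_neighbours:
  assumes dr: "drackn (roux_graph n B) (fibres n)"
  obtains a c where "\<And>i j g. i < n \<Longrightarrow> j < n \<Longrightarrow> i \<noteq> j \<Longrightarrow>
    card {k \<in> {..<n} - {i, j}. b i k + b k j = g} = (if g = b i j then a else c)"
proof -
  let ?G = "roux_graph n B"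
  interpret pair_graph ?G using dr by (simp add: drackn_def complete_graph_cover_def)
  have verts: "pverts ?G = {..<n} \<times> UNIV" by (simp add: roux_graph_def)
  have "distance_regular ?G" using dr by (simp add: drackn_def)
  note common = distance_regular_common_neighbours[OF this]
  obtain a where a: "\<And>u v. u \<in> pverts ?G \<Longrightarrow> v \<in> pverts ?G \<Longrightarrow> gdist ?G u v = 1 \<Longrightarrow>
    card {w \<in> pverts ?G. gdist ?G u w = 1 \<and> gdist ?G v w = 1} = a" using common by blast
  obtain c where c: "\<And>u v. u \<in> pverts ?G \<Longrightarrow> v \<in> pverts ?G \<Longrightarrow> gdist ?G u v = 2 \<Longrightarrow>
    card {w \<in> pverts ?G. gdist ?G u w = 1 \<and> gdist ?G v w = 1} = c" using common by blast
  have "card {k \<in> {..<n} - {i, j}. b i k + b k j = g} = (if g = b i j then a else c)"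
    if ij: "i < n" "j < n" "i \<noteq> j" for i j g
  proof -
    have V: "(i, g) \<in> pverts ?G" "(j, 0) \<in> pverts ?G" using ij by (simp_all add: verts)
    have "{w \<in> pverts ?G. gdist ?G (i, g) w = 1 \<and> gdist ?G (j, 0) w = 1} =
        {w \<in> pverts ?G. ((i, g), w) \<in> parcs ?G \<and> ((j, 0), w) \<in> parcs ?G}"
      using gdist_eq_1_iff V by blast
    \<comment> \<open>Adjacency to \<open>(j, 0)\<close> determines the second coordinate of a
      vertex in fibre \<open>k\<close>, namely \<open>- b j k = b k j\<close>.\<close>
    also have "\<dots> = (\<lambda>k. (k, b k j)) ` {k \<in> {..<n} - {i, j}. b i k + b k j = g}"
    proof (rule equalityI; rule subsetI)
      fix w assume "w \<in> {w \<in> pverts ?G. ((i, g), w) \<in> parcs ?G \<and> ((j, 0), w) \<in> parcs ?G}"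
      moreover obtain k x where w: "w = (k, x)" by force
      ultimately have k: "k < n" "i \<noteq> k" "j \<noteq> k" "b i k + x = g" "b j k + x = 0"
        by (simp_all add: arc_iff)
      then have "x = b k j" using skew[of k j] ij by (simp add: eq_neg_iff_add_eq_0 add.commute)
      then show "w \<in> (\<lambda>k. (k, b k j)) ` {k \<in> {..<n} - {i, j}. b i k + b k j = g}"
        using k w by blast
    next
      fix w assume "w \<in> (\<lambda>k. (k, b k j)) ` {k \<in> {..<n} - {i, j}. b i k + b k j = g}"
      then obtain k where k: "w = (k, b k j)" "k < n" "k \<noteq> i" "k \<noteq> j" "b i k + b k j = g"
        by blast
      then show "w \<in> {w \<in> pverts ?G. ((i, g), w) \<in> parcs ?G \<and> ((j, 0), w) \<in> parcs ?G}"
        using ij skew[of k j] by (simp add: arc_iff verts)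
    qed
    finally have card: "card {w \<in> pverts ?G. gdist ?G (i, g) w = 1 \<and> gdist ?G (j, 0) w = 1} =
        card {k \<in> {..<n} - {i, j}. b i k + b k j = g}"
      by (simp add: card_image inj_on_def)
    show ?thesis
    proof (cases "g = b i j")
      case True
      then have "((i, g), (j, 0)) \<in> parcs ?G" using ij by (simp add: arc_iff)
      then have "gdist ?G (i, g) (j, 0) = 1" using gdist_eq_1_iff V by blast
      from a[OF V this] show ?thesis using True card by simp
    next
      case False
      then have nonadj: "((i, g), (j, 0)) \<notin> parcs ?G" by (simp add: arc_iff)
      have "{i} \<times> UNIV \<in> (fibres n :: (nat \<times> 'g) set set)"
        "{j} \<times> UNIV \<in> (fibres n :: (nat \<times> 'g) set set)"
        using ij by (simp_all add: fibres_def)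
      moreover have "{i} \<times> UNIV \<noteq> {j} \<times> (UNIV :: 'g set)" using ij by blast
      ultimately have "gdist ?G (i, g) (j, 0) = 2"
        by (rule drackn_gdist_eq_2[OF dr]) (simp_all add: nonadj)
      from c[OF V this] show ?thesis using False card by simp
    qed
  qed
  then show ?thesis by (rule that)
qed

lemma quadratic_signatureI:
  assumes \<alpha>: "character \<alpha>"
    and mult: "\<And>i j. i < n \<Longrightarrow> j < n \<Longrightarrow> i \<noteq> j \<Longrightarrow>
      (\<Sum>k\<in>{..<n} - {i, j}. \<alpha> (b i k + b k j)) = of_real \<delta> * \<alpha> (b i j)"
  shows "quadratic_signature n \<delta> (\<lambda>i j. char_lin \<alpha> (B $$ (i, j)))"
proof -
  have square: "(\<Sum>k<n. char_lin \<alpha> (B $$ (i, k)) * char_lin \<alpha> (B $$ (k, j))) =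
      of_real \<delta> * char_lin \<alpha> (B $$ (i, j))" if ij: "i < n" "j < n" "i \<noteq> j" for i j
  proof -
    have "(\<Sum>k<n. char_lin \<alpha> (B $$ (i, k)) * char_lin \<alpha> (B $$ (k, j))) =
        (\<Sum>k\<in>{..<n} - {i, j}. \<alpha> (b i k + b k j))"
      by (rule sum.mono_neutral_cong_right)
        (use ij \<alpha> in \<open>auto simp: diag off_diag character_def char_lin_def[of _ 0]\<close>)
    then show ?thesis using mult ij by (simp add: off_diag)
  qed
  have norm: "cmod (char_lin \<alpha> (B $$ (i, j))) = 1"
    if "i < n" "j < n" "i \<noteq> j" for i j
    using \<alpha> by (simp add: off_diag[OF that] character_def)
  have herm: "char_lin \<alpha> (B $$ (j, i)) = cnj (char_lin \<alpha> (B $$ (i, j)))"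
    if "i < n" "j < n" "i \<noteq> j" for i j
  proof -
    have "B $$ (j, i) = group_elem (- b i j)"
      using off_diag[OF that(2,1) that(3)[symmetric]] by (simp only: skew[OF that])
    then show ?thesis
      by (simp only: off_diag[OF that] char_lin_group_elem character_uminus[OF \<alpha>])
  qed
  show ?thesis
    unfolding quadratic_signature_def
    by (intro conjI allI impI)
      (simp add: diag char_lin_def[of _ 0], (rule norm herm square; assumption)+)
qed

text \<open>Grouping the products by their value \<open>g\<close> gives \<open>c\<close> times the
  full character sum, which vanishes, plus \<open>(a - c) \<alpha> (b i j)\<close>. Hence
  \<open>\<delta> = a - c\<close>, a single constant for all nontrivial characters.\<close>

lemma nontrivial_character_quadratic:
  assumes dr: "drackn (roux_graph n B) (fibres n)"
  obtains \<delta> where "\<And>\<alpha> h. character \<alpha> \<Longrightarrow> \<alpha> h \<noteq> 1 \<Longrightarrow>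
    quadratic_signature n \<delta> (\<lambda>i j. char_lin \<alpha> (B $$ (i, j)))"
proof -
  obtain a c where ac: "\<And>i j g. i < n \<Longrightarrow> j < n \<Longrightarrow> i \<noteq> j \<Longrightarrow>
    card {k \<in> {..<n} - {i, j}. b i k + b k j = g} = (if g = b i j then a else c)"
    using common_neighbours[OF dr] by blast
  have "quadratic_signature n (real a - real c) (\<lambda>i j. char_lin \<alpha> (B $$ (i, j)))"
    if \<alpha>: "character \<alpha>" "\<alpha> h \<noteq> 1" for \<alpha> h
  proof (rule quadratic_signatureI[OF \<alpha>(1)])
    fix i j assume ij: "i < n" "j < n" "i \<noteq> j"
    let ?K = "{..<n} - {i, j}"
    have "(\<Sum>k\<in>?K. \<alpha> (b i k + b k j)) =
        (\<Sum>g\<in>UNIV. \<Sum>k\<in>{k \<in> ?K. b i k + b k j = g}. \<alpha> (b i k + b k j))"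
      by (rule sum.group[symmetric]) auto
    also have "\<dots> = (\<Sum>g\<in>UNIV. of_nat (card {k \<in> ?K. b i k + b k j = g}) * \<alpha> g)"
      by (intro sum.cong refl) simp
    also have "\<dots> = (\<Sum>g\<in>UNIV. of_nat c * \<alpha> g +
        (if g = b i j then (of_nat a - of_nat c) * \<alpha> g else 0))"
      unfolding ac[OF ij] by (intro sum.cong refl) (simp add: algebra_simps)
    also have "\<dots> = of_nat c * (\<Sum>g\<in>UNIV. \<alpha> g) + (of_nat a - of_nat c) * \<alpha> (b i j)"
      by (simp add: sum.distrib sum_distrib_left)
    finally show "(\<Sum>k\<in>?K. \<alpha> (b i k + b k j)) = of_real (real a - real c) * \<alpha> (b i j)"
      by (simp add: sum_character[OF \<alpha>])
  qed
  then show ?thesis by (rule that)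
qed

text \<open>The trivial character turns \<open>B\<close> into J - I with J the all-ones matrix, and
  (J - I)^2 = (n - 2) (J - I) + (n - 1) I.\<close>

lemma trivial_character_quadratic:
  assumes "\<And>g. \<alpha> g = 1"
  shows "quadratic_signature n (real n - 2) (\<lambda>i j. char_lin \<alpha> (B $$ (i, j)))"
proof (rule quadratic_signatureI)
  show "character \<alpha>" using assms by (simp add: character_def)
  fix i j assume ij: "i < n" "j < n" "i \<noteq> j"
  then have "card ({..<n} - {i, j}) = n - 2" "n \<ge> 2" by (auto simp: card_Diff_subset)
  then show "(\<Sum>k\<in>{..<n} - {i, j}. \<alpha> (b i k + b k j)) = of_real (real n - 2) * \<alpha> (b i j)"
    by (simp add: assms of_nat_diff)
qed

text \<open>The entrywise square of the matrix for \<open>\<alpha>\<close> is the matrix for the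
  squared character. If that character is nontrivial, so is \<open>\<alpha>\<close>, and both share
  the same constant; if it is trivial, \<open>\<delta>2\<close> is \<open>n - 2\<close>.\<close>

lemma character_quadratic:
  assumes dr: "drackn (roux_graph n B) (fibres n)" and \<alpha>: "character \<alpha>"
  obtains \<delta> \<delta>2 where "\<delta>2 = \<delta> \<or> \<delta>2 = real n - 2"
    "quadratic_signature n \<delta> (\<lambda>i j. char_lin \<alpha> (B $$ (i, j)))"
    "quadratic_signature n \<delta>2 (\<lambda>i j. (char_lin \<alpha> (B $$ (i, j)))\<^sup>2)"
proof -
  let ?\<alpha>2 = "\<lambda>g. (\<alpha> g)\<^sup>2"
  have \<alpha>2: "character ?\<alpha>2"
    using \<alpha> by (simp add: character_def norm_power power_mult_distrib)
  have square: "(char_lin \<alpha> (B $$ (i, j)))\<^sup>2 = char_lin ?\<alpha>2 (B $$ (i, j))"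
    if "i < n" "j < n" for i j
    using that by (cases "i = j") (simp_all add: diag off_diag char_lin_def[of _ 0])
  obtain \<delta> where \<delta>: "\<And>\<alpha> h. character \<alpha> \<Longrightarrow> \<alpha> h \<noteq> 1 \<Longrightarrow>
    quadratic_signature n \<delta> (\<lambda>i j. char_lin \<alpha> (B $$ (i, j)))"
    using nontrivial_character_quadratic[OF dr] by blast
  show ?thesis
  proof (cases "\<forall>g. ?\<alpha>2 g = 1")
    case True
    then have 2: "quadratic_signature n (real n - 2) (\<lambda>i j. char_lin ?\<alpha>2 (B $$ (i, j)))"
      by (intro trivial_character_quadratic) blast
    have "\<exists>\<delta>. quadratic_signature n \<delta> (\<lambda>i j. char_lin \<alpha> (B $$ (i, j)))"
    proof (cases "\<forall>g. \<alpha> g = 1")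
      case True
      then have "quadratic_signature n (real n - 2) (\<lambda>i j. char_lin \<alpha> (B $$ (i, j)))"
        by (intro trivial_character_quadratic) blast
      then show ?thesis by (rule exI)
    next
      case False
      then obtain h where "\<alpha> h \<noteq> 1" by blast
      from \<delta>[OF \<alpha> this] show ?thesis by (rule exI)
    qed
    then obtain \<delta>1 where "quadratic_signature n \<delta>1 (\<lambda>i j. char_lin \<alpha> (B $$ (i, j)))" ..
    with 2 show ?thesis
      by (intro that[of "real n - 2" \<delta>1])
        (simp_all only: quadratic_signature_cong[OF square] simp_thms)
  next
    case False
    then obtain h where h: "?\<alpha>2 h \<noteq> 1" by blast
    then have "\<alpha> h \<noteq> 1" by auto
    with \<delta>[OF \<alpha>] \<delta>[of ?\<alpha>2, OF \<alpha>2 h] show ?thesis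
      by (intro that[of \<delta> \<delta>])
        (simp_all only: quadratic_signature_cong[OF square] simp_thms)
  qed
qed

end

lemma roux_imp_voltage:
  assumes "roux n B"
  obtains b where "roux_voltage n B b"
proof -
  from assms have diag: "\<forall>i<n. B $$ (i, i) = 0"
    and off: "\<forall>i<n. \<forall>j<n. i \<noteq> j \<longrightarrow> (\<exists>g. B $$ (i, j) = group_elem g)"
    and skew: "\<forall>i<n. \<forall>j<n. \<forall>g. i \<noteq> j \<longrightarrow> B $$ (i, j) = group_elem g \<longrightarrow>
        B $$ (j, i) = group_elem (- g)"
    unfolding roux_def by blast+
  define b where "b i j = (SOME g. B $$ (i, j) = group_elem g)" for i j
  have b: "B $$ (i, j) = group_elem (b i j)" if "i < n" "j < n" "i \<noteq> j" for i j
    unfolding b_def by (rule someI_ex) (use off that in blast)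
  have "b j i = - b i j" if "i < n" "j < n" "i \<noteq> j" for i j
  proof -
    have "B $$ (j, i) = group_elem (- b i j)" using skew b[of i j] that by blast
    \<comment> \<open>Evaluating two equal group elements at \<open>b j i\<close> identifies their
      exponents.\<close>
    then have "Poly_Mapping.lookup (group_elem (b j i)) (b j i) =
        Poly_Mapping.lookup (group_elem (- b i j)) (b j i)"
      using b[of j i] that by simp
    then show ?thesis by (simp add: lookup_single when_def split: if_splits)
  qed
  then have "roux_voltage n B b" using diag b by (intro roux_voltage.intro) blast+
  then show ?thesis by (rule that)
qed

section \<open>Gram matrices of spanning lines\<close>

text \<open>The annihilator of \<open>x\<close> under the bilinear product, taken without
  conjugation, is a subspace.\<close>

lemma cspan_orthogonal:
  assumes S: "S \<subseteq> carrier_vec m" and x: "x \<in> carrier_vec m"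
    and orth: "\<And>v. v \<in> S \<Longrightarrow> scalar_prod x v = 0" and w: "w \<in> cspan m S"
  shows "scalar_prod x w = 0"
proof -
  interpret vec_space "TYPE(complex)" m .
  let ?N = "{v \<in> carrier_vec m. scalar_prod x v = 0}"
  have "span S \<subseteq> ?N"
  proof (rule span_is_subset)
    show "S \<subseteq> ?N" using S orth by blast
    show "submodule class_ring ?N V"
      using x by unfold_locales (auto simp: scalar_prod_add_distrib[of _ m])
  qed
  then show ?thesis using w by blast
qed

text \<open>Supplies the dual form of spanning used in \<open>gram_projection\<close>. A unit vector
  \<open>\<phi> i\<close> is a nonzero multiple of a generator of \<open>L i\<close>, so a
  functional vanishing on all \<open>\<phi> i\<close> vanishes on the whole span, in particular on
  the unit vectors.\<close>

lemma lines_span_separating: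
  assumes lines: "\<And>i. i < n \<Longrightarrow> line m (L i)"
    and \<phi>: "\<And>i. i < n \<Longrightarrow> \<phi> i \<in> L i" "\<And>i. i < n \<Longrightarrow> \<phi> i \<bullet>c \<phi> i = 1"
    and span: "lines_span m n L = carrier_vec m"
    and x: "\<And>i. i < n \<Longrightarrow> (\<Sum>a<m. x a * vec_index (\<phi> i) a) = 0" and a: "a < m"
  shows "x a = 0"
proof -
  interpret vec_space "TYPE(complex)" m .
  let ?x = "Matrix.vec m x"
  have "v \<in> carrier_vec m \<and> scalar_prod ?x v = 0" if i: "i < n" and v: "v \<in> L i" for i v
  proof -
    obtain u where u: "u \<in> carrier_vec m" "L i = span {u}"
      using lines[OF i] by (auto simp: line_def)
    have multiple: "\<exists>c. w = c \<cdot>\<^sub>v u" if "w \<in> L i" for w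
    proof -
      have "w \<in> {lincomb f {u} | f. f \<in> UNIV}"
        using that u(2) finite_span[of "{u}"] u(1) by simp
      then obtain f where "w = lincomb f {u}" by blast
      then have "w = f u \<cdot>\<^sub>v u" using u by (simp add: lincomb_def)
      then show ?thesis ..
    qed
    obtain c where c: "\<phi> i = c \<cdot>\<^sub>v u" using multiple \<phi>(1)[OF i] by blast
    obtain e where e: "v = e \<cdot>\<^sub>v u" using multiple v by blast
    have "c \<noteq> 0"
    proof
      assume "c = 0"
      then have "\<phi> i = 0\<^sub>v m" using c u by simp
      then show False using \<phi>(2)[OF i] by simp
    qed
    moreover have "scalar_prod ?x (\<phi> i) = 0"
      using x[OF i] u c by (simp add: scalar_prod_def lessThan_atLeast0)
    ultimately have "scalar_prod ?x u = 0" using c u by simp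
    then show ?thesis using e u by simp
  qed
  then have sub: "(\<Union>i<n. L i) \<subseteq> carrier_vec m"
    and orth: "\<And>v. v \<in> (\<Union>i<n. L i) \<Longrightarrow> scalar_prod ?x v = 0"
    by blast+
  have "unit_vec m a \<in> cspan m (\<Union>i<n. L i)"
    using span by (simp add: lines_span_def)
  from cspan_orthogonal[OF sub _ orth this] have "scalar_prod ?x (unit_vec m a) = 0" by simp
  then show ?thesis using a by simp
qed

lemma line_carrier: "line m l \<Longrightarrow> v \<in> l \<Longrightarrow> v \<in> carrier_vec m"
proof -
  interpret vec_space "TYPE(complex)" m .
  assume "line m l" "v \<in> l"
  then obtain u where "u \<in> carrier_vec m" "v \<in> span {u}" unfolding line_def by blast
  then show "v \<in> carrier_vec m" by (intro span_closed[of "{u}"]) auto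
qed

lemma has_signature_matrix_gram:
  assumes "has_signature_matrix n \<phi> S" and \<phi>: "\<And>i. i < n \<Longrightarrow> \<phi> i \<in> carrier_vec m"
  obtains \<mu> :: real where "\<mu> > 0" "\<And>i j. i < n \<Longrightarrow> j < n \<Longrightarrow>
    (\<Sum>a<m. cnj (vec_index (\<phi> i) a) * vec_index (\<phi> j) a) = affine 1 \<mu> (\<lambda>i j. S $$ (i, j)) i j"
proof -
  from assms(1) obtain \<mu> :: real where S: "S \<in> carrier_mat n n" and \<mu>: "\<mu> > 0"
    and eq: "mat n n (\<lambda>(i, j). \<phi> j \<bullet>c \<phi> i) = 1\<^sub>m n + complex_of_real \<mu> \<cdot>\<^sub>m S"
    unfolding has_signature_matrix_def by blast
  have "(\<Sum>a<m. cnj (vec_index (\<phi> i) a) * vec_index (\<phi> j) a) = affine 1 \<mu> (\<lambda>i j. S $$ (i, j)) i j"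
    if "i < n" "j < n" for i j
  proof -
    have "(\<Sum>a<m. cnj (vec_index (\<phi> i) a) * vec_index (\<phi> j) a) = \<phi> j \<bullet>c \<phi> i"
      using \<phi>[OF that(1)] by (simp add: scalar_prod_def lessThan_atLeast0 mult.commute)
    also have "\<dots> = mat n n (\<lambda>(i, j). \<phi> j \<bullet>c \<phi> i) $$ (i, j)" using that by simp
    also have "\<dots> = affine 1 \<mu> (\<lambda>i j. S $$ (i, j)) i j"
      unfolding eq using that S by (simp add: affine_def)
    finally show ?thesis .
  qed
  with \<mu> show ?thesis by (rule that)
qed

text \<open>Collects what the final count needs. The sign of \<open>y = \<mu> m / n\<close> is kept
  because it separates the two dimensions: the rank \<open>d\<close> analysis only allows a negative
  coefficient.\<close>

lemma drackn_lines_projection: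
  fixes L :: "nat \<Rightarrow> complex vec set"
  assumes lines: "drackn_lines TYPE('g::{ab_group_add, finite}) m n L"
    and span: "lines_span m n L = carrier_vec m" and mn: "m < n"
  obtains s \<delta> \<delta>2 y where "n \<ge> 2" "y \<ge> 0" "\<delta>2 = \<delta> \<or> \<delta>2 = real n - 2"
    "quadratic_signature n \<delta> s" "quadratic_signature n \<delta>2 (\<lambda>i j. (s i j)\<^sup>2)"
    "(real m / real n)\<^sup>2 + y\<^sup>2 * (real n - 1) = real m / real n"
    "2 * (real m / real n) * y + y\<^sup>2 * \<delta> = y"
proof -
  from lines obtain B :: "'g group_alg mat" and \<alpha> \<phi> where
    L: "\<forall>i<n. line m (L i)" and B: "roux n B" and \<alpha>: "character \<alpha>"
    and dr: "drackn (roux_graph n B) (fibres n)"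
    and \<phi>: "\<forall>i<n. \<phi> i \<in> L i \<and> \<phi> i \<bullet>c \<phi> i = 1"
    and sig: "has_signature_matrix n \<phi> (char_mat \<alpha> B)"
    unfolding drackn_lines_def by blast
  from B have n: "n \<ge> 2" and dim: "B \<in> carrier_mat n n" unfolding roux_def by blast+
  obtain b where "roux_voltage n B b" using roux_imp_voltage[OF B] by blast
  then interpret roux_voltage n B b .
  let ?s = "\<lambda>i j. char_lin \<alpha> (B $$ (i, j))"
  obtain \<delta> \<delta>2 where \<delta>: "\<delta>2 = \<delta> \<or> \<delta>2 = real n - 2"
    and s: "quadratic_signature n \<delta> ?s" and s2: "quadratic_signature n \<delta>2 (\<lambda>i j. (?s i j)\<^sup>2)"
    using character_quadratic[OF dr \<alpha>] by blast
  have carrier: "\<phi> i \<in> carrier_vec m" if "i < n" for i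
    using line_carrier L \<phi> that by blast
  obtain \<mu> :: real where \<mu>: "\<mu> > 0" and gram: "\<And>i j. i < n \<Longrightarrow> j < n \<Longrightarrow>
    (\<Sum>a<m. cnj (vec_index (\<phi> i) a) * vec_index (\<phi> j) a) =
      affine 1 \<mu> (\<lambda>i j. char_mat \<alpha> B $$ (i, j)) i j"
    using has_signature_matrix_gram[OF sig carrier] by blast
  have gram': "(\<Sum>a<m. cnj (vec_index (\<phi> i) a) * vec_index (\<phi> j) a) = affine 1 \<mu> ?s i j"
    if "i < n" "j < n" for i j
    using gram[OF that] that dim by (simp add: affine_def)
  have separating: "w a = 0"
    if "\<And>i. i < n \<Longrightarrow> (\<Sum>a<m. w a * vec_index (\<phi> i) a) = 0" "a < m" for w a
    by (rule lines_span_separating[OF _ _ _ span that]) (use L \<phi> in blast)+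
  have idem: "(real m / real n)\<^sup>2 + (\<mu> * (real m / real n))\<^sup>2 * (real n - 1) = real m / real n"
    "2 * (real m / real n) * (\<mu> * (real m / real n)) + (\<mu> * (real m / real n))\<^sup>2 * \<delta> =
      \<mu> * (real m / real n)"
    by (rule gram_projection[where \<phi> = "\<lambda>i. vec_index (\<phi> i)" and \<mu> = \<mu>, OF s mn _ _ refl refl];
        fact gram' separating)+
  show ?thesis
    by (rule that[OF n _ \<delta> s s2 idem]) (use \<mu> in simp)
qed

section \<open>The dimensions \<open>d\<close> and \<open>d^2 - d\<close>\<close>

theorem corollary5p5:
  fixes d :: nat
  assumes "d > 0"
  shows "\<not> (\<exists>L. drackn_lines TYPE('g::{ab_group_add, finite}) d (d^2) L \<and>
                lines_span d (d^2) L = carrier_vec d) \<and>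
         ((\<exists>L. drackn_lines TYPE('g) (d^2 - d) (d^2) L \<and>
                lines_span (d^2 - d) (d^2) L = carrier_vec (d^2 - d)) \<longrightarrow> d = 3)"
proof (intro conjI impI notI)
  \<comment> \<open>The size of a roux is at least 2, which excludes \<open>d = 1\<close>.\<close>
  have d2: "d \<ge> 2" if "d\<^sup>2 \<ge> 2"
    using that assms by (cases "d = 1") simp_all
  {
    assume "\<exists>L. drackn_lines TYPE('g) d (d^2) L \<and> lines_span d (d^2) L = carrier_vec d"
    then obtain L where L: "drackn_lines TYPE('g) d (d^2) L" "lines_span d (d^2) L = carrier_vec d"
      by blast
    from L(1) have "d\<^sup>2 \<ge> 2" unfolding drackn_lines_def roux_def by blast
    then have d: "d \<ge> 2" by (rule d2)
    then have "d < d\<^sup>2" by (simp add: power2_eq_square)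
    from drackn_lines_projection[OF L this] obtain s \<delta> \<delta>2 y where y: "y \<ge> 0"
      and *: "\<delta>2 = \<delta> \<or> \<delta>2 = real (d\<^sup>2) - 2"
      "quadratic_signature (d\<^sup>2) \<delta> s" "quadratic_signature (d\<^sup>2) \<delta>2 (\<lambda>i j. (s i j)\<^sup>2)"
      "(real d / real (d\<^sup>2))\<^sup>2 + y\<^sup>2 * (real (d\<^sup>2) - 1) = real d / real (d\<^sup>2)"
      "2 * (real d / real (d\<^sup>2)) * y + y\<^sup>2 * \<delta> = y" by metis
    have "real d / real (d\<^sup>2) = 1 / real d" by (simp add: power2_eq_square)
    \<comment> \<open>The conclusion \<open>y < 0\<close> contradicts the sign inherited from
      \<open>\<mu> > 0\<close>.\<close>
    from signature_d_square[OF d refl this *(2,3,1,4,5)] y show False by simp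
  }
  {
    assume "\<exists>L. drackn_lines TYPE('g) (d^2 - d) (d^2) L \<and>
      lines_span (d^2 - d) (d^2) L = carrier_vec (d^2 - d)"
    then obtain L where L: "drackn_lines TYPE('g) (d^2 - d) (d^2) L"
      "lines_span (d^2 - d) (d^2) L = carrier_vec (d^2 - d)" by blast
    let ?x = "real (d\<^sup>2 - d) / real (d\<^sup>2)"
    have "d\<^sup>2 - d < d\<^sup>2" using assms by simp
    from drackn_lines_projection[OF L this] obtain s \<delta> \<delta>2 y where n: "d\<^sup>2 \<ge> 2"
      and *: "\<delta>2 = \<delta> \<or> \<delta>2 = real (d\<^sup>2) - 2"
      "quadratic_signature (d\<^sup>2) \<delta> s" "quadratic_signature (d\<^sup>2) \<delta>2 (\<lambda>i j. (s i j)\<^sup>2)"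
      and idem: "?x\<^sup>2 + y\<^sup>2 * (real (d\<^sup>2) - 1) = ?x" "2 * ?x * y + y\<^sup>2 * \<delta> = y" by metis
    have "d \<le> d\<^sup>2" by (simp add: power2_eq_square)
    then have x: "1 - ?x = 1 / real d"
      using assms by (simp add: of_nat_diff field_simps power2_eq_square)
    \<comment> \<open>The complementary projection \<open>(1 - ?x) I - y S\<close> has rank
      \<open>d\<close>, so the same analysis applies with \<open>- y\<close> in place of
      \<open>y\<close>, where a negative coefficient is no contradiction.\<close>
    have "(1 - ?x)\<^sup>2 + (- y)\<^sup>2 * (real (d\<^sup>2) - 1) = 1 - ?x"
      using idem(1) unfolding power2_diff by simp
    moreover have "2 * (1 - ?x) * - y + (- y)\<^sup>2 * \<delta> = - y"
      using idem(2) unfolding left_diff_distrib right_diff_distrib by simp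
    ultimately show "d = 3"
      using signature_d_square[OF d2[OF n] refl x *(2,3,1)] by blast
  }
qed

end
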